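(* Consider the Gaussian white noise regression model in wavelet form: given $f$, one observes independently $X_{lk}\mid f_{lk}\sim\mathcal N(f_{lk},1/n)$ for $l\ge0$, $k\in\mathcal K_l$, and write $X^{(n)}=(X_{lk})_{l,k}$. Let $h$ be a probability density on $\mathbb R$ such that: (i) $h$ is symmetric, positive, bounded, and decreasing on $[0,\infty)$; (ii) for some $c_1>0$, $\kappa\ge0$, $\log(1/h(x))\le c_1(1+\log^{1+\kappa}(1+x))$ for all $x\ge0$; (iii) $\int_{-\infty}^\infty|x|^qh(x)\,dx<\infty$ for some $q\ge1$. Let $\Pi$ be the prior on $f=\sum_{l,k}f_{lk}\psi_{lk}$ under which $f_{lk}=s_l\zeta_{lk}$ with $(\zeta_{lk})$ i.i.d. of density $h$ and $s_l=2^{-l^2}$. Suppose $f_0\in\mathcal H^\beta(L)$ for some $\beta,L>0$. Then there exists $d>0$ such that, with $\mathcal L_n=(\log n)^d$, as $n\to\infty$, $$E_{f_0}\Pi\left[\{f:\ \|f-f_0\|_\infty>\mathcal L_n\,(\log n/n)^{\beta/(2\beta+1)}\}\,\middle|\,X^{(n)}\right]\to0.$$ Further, the same result holds, with a possibly different $d$, when instead $s_l=2^{-l(1/2+\alpha)}$ for some $\alpha>0$ (with (iii) holding for some $q\ge1$), provided $\alpha\ge\beta+1/q$.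
   Context: $\{\psi_{lk}:l\ge0,k\in\mathcal K_l\}$, $\mathcal K_l=\{0,\dots,2^l-1\}$, is an orthonormal boundary-corrected wavelet basis of $L^2[0,1]$ (the scaling function being denoted as the first wavelet $\psi_{00}$); such a basis satisfies $\sup_{x\in[0,1]}\sum_{k\in\mathcal K_l}|\psi_{lk}(x)|\le C2^{l/2}$ for all $l$ and a constant $C$. Write $f_{lk}=\langle f,\psi_{lk}\rangle$. The Hölder-type ball is $\mathcal H^\beta(L)=\{f=(f_{lk}):\ \max_{k\in\mathcal K_l}|f_{lk}|\le2^{-l(1/2+\beta)}L\ \text{for all } l\ge0\}$. $\|\cdot\|_\infty$ is the supremum norm on $[0,1]$. $\Pi[\cdot\mid X^{(n)}]$ is the posterior distribution of $f$ given $X^{(n)}$: under it the $f_{lk}$ are independent, $f_{lk}$ having density proportional to $\theta\mapsto e^{-n(X_{lk}-\theta)^2/2}h(\theta/s_l)$. $E_{f_0}$ is the expectation when $X_{lk}\sim\mathcal N(f_{0,lk},1/n)$ independently. *)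

theory Defs
  imports "HOL-Probability.Probability"
begin

section \<open>Wavelet-type bases of \<open>L\<^sup>2[0,1]\<close>\<close>

definition square_integrable_unit :: "(real \<Rightarrow> real) \<Rightarrow> bool" where
  "square_integrable_unit f \<longleftrightarrow>
     f \<in> borel_measurable (lebesgue_on {0..1}) \<and> integrable (lebesgue_on {0..1}) (\<lambda>x. (f x)\<^sup>2)"

definition inner_unit :: "(real \<Rightarrow> real) \<Rightarrow> (real \<Rightarrow> real) \<Rightarrow> real" where
  "inner_unit f g = integral\<^sup>L (lebesgue_on {0..1}) (\<lambda>x. f x * g x)"

text \<open>The index pairs \<open>(l, k)\<close> with \<open>k \<in> {0, \<dots>, 2^l - 1}\<close>.\<close>

definition wavelet_index :: "(nat \<times> nat) set" where
  "wavelet_index = (SIGMA l:UNIV. {..<2 ^ l})"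

definition wavelet_level :: "(nat \<Rightarrow> nat \<Rightarrow> real \<Rightarrow> real) \<Rightarrow> (nat \<times> nat \<Rightarrow> real) \<Rightarrow> nat \<Rightarrow> real \<Rightarrow> real"
  where "wavelet_level \<psi> \<theta> l x = (\<Sum>k<2 ^ l. \<theta> (l, k) * \<psi> l k x)"

definition wavelet_coeff :: "(nat \<Rightarrow> nat \<Rightarrow> real \<Rightarrow> real) \<Rightarrow> (real \<Rightarrow> real) \<Rightarrow> nat \<times> nat \<Rightarrow> real" where
  "wavelet_coeff \<psi> f = (\<lambda>(l, k). inner_unit f (\<psi> l k))"

text \<open>Boundary-corrected wavelet bases are represented by all orthonormal bases of \<open>L\<^sup>2[0,1]\<close> with
  this indexing (the scaling function being \<open>\<psi> 0 0\<close>) that are localised in the sense of the last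
  conjunct. The \<open>\<psi> l k\<close> are genuine functions, not equivalence classes, as the localisation bound
  and the supremum norm are pointwise.\<close>

definition wavelet_basis :: "(nat \<Rightarrow> nat \<Rightarrow> real \<Rightarrow> real) \<Rightarrow> bool" where
  "wavelet_basis \<psi> \<longleftrightarrow>
     (\<forall>(l, k) \<in> wavelet_index. square_integrable_unit (\<psi> l k)) \<and>
     (\<forall>(l, k) \<in> wavelet_index. \<forall>(l', k') \<in> wavelet_index.
        inner_unit (\<psi> l k) (\<psi> l' k') = (if (l, k) = (l', k') then 1 else 0)) \<and>
     (\<forall>f. square_integrable_unit f \<longrightarrow>
        (\<lambda>N. integral\<^sup>L (lebesgue_on {0..1})
               (\<lambda>x. (f x - (\<Sum>l<N. wavelet_level \<psi> (wavelet_coeff \<psi> f) l x))\<^sup>2)) \<longlonglongrightarrow> 0) \<and>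
     (\<exists>C. \<forall>l. \<forall>x\<in>{0..1}. (\<Sum>k<2 ^ l. \<bar>\<psi> l k x\<bar>) \<le> C * 2 powr (real l / 2))"

text \<open>The coefficients determine \<open>f\<close> only almost everywhere; the second conjunct selects the
  representative \<open>f = (\<Sum>l. \<Sum>k. f\<^sub>l\<^sub>k \<psi>\<^sub>l\<^sub>k)\<close> with pointwise summation. Given the third conjunct and
  localisation, this series converges absolutely and uniformly on \<open>[0,1]\<close>.\<close>

definition holder_ball :: "(nat \<Rightarrow> nat \<Rightarrow> real \<Rightarrow> real) \<Rightarrow> real \<Rightarrow> real \<Rightarrow> (real \<Rightarrow> real) set" where
  "holder_ball \<psi> \<beta> L = {f. square_integrable_unit f \<and>
     (\<forall>x\<in>{0..1}. (\<lambda>l. wavelet_level \<psi> (wavelet_coeff \<psi> f) l x) sums f x) \<and>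
     (\<forall>l. (MAX k\<in>{..<2 ^ l}. \<bar>wavelet_coeff \<psi> f (l, k)\<bar>) \<le> 2 powr (- real l * (1/2 + \<beta>)) * L)}"

text \<open>\<open>\<parallel>f - f\<^sub>0\<parallel>\<^sub>\<infinity>\<close> for \<open>f = (\<Sum>l. \<Sum>k. \<theta>\<^sub>l\<^sub>k \<psi>\<^sub>l\<^sub>k)\<close>. Arrays \<open>\<theta>\<close> whose series diverges somewhere
  on \<open>[0,1]\<close> are put at infinite distance.\<close>

definition sup_dist :: "(nat \<Rightarrow> nat \<Rightarrow> real \<Rightarrow> real) \<Rightarrow> (nat \<times> nat \<Rightarrow> real) \<Rightarrow> (real \<Rightarrow> real) \<Rightarrow> ereal" where
  "sup_dist \<psi> \<theta> f0 =
     (if \<forall>x\<in>{0..1}. summable (\<lambda>l. wavelet_level \<psi> \<theta> l x)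
      then SUP x\<in>{0..1}. ereal \<bar>(\<Sum>l. wavelet_level \<psi> \<theta> l x) - f0 x\<bar>
      else \<infinity>)"

section \<open>White noise model, prior and posterior\<close>

definition white_noise :: "(nat \<times> nat \<Rightarrow> real) \<Rightarrow> nat \<Rightarrow> (nat \<times> nat \<Rightarrow> real) measure" where
  "white_noise \<theta> n =
     (\<Pi>\<^sub>M i\<in>wavelet_index. density lborel (normal_density (\<theta> i) (1 / sqrt (real n))))"

definition heavy_tailed_density :: "(real \<Rightarrow> real) \<Rightarrow> real \<Rightarrow> real \<Rightarrow> real \<Rightarrow> bool" where
  "heavy_tailed_density h c1 \<kappa> q \<longleftrightarrow>
     h \<in> borel_measurable borel \<and> integrable lborel h \<and> integral\<^sup>L lborel h = 1 \<and>
     (\<forall>x. h (- x) = h x) \<and> (\<forall>x. h x > 0) \<and> (\<exists>B. \<forall>x. h x \<le> B) \<and> antimono_on {0..} h \<and>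
     (\<forall>x\<ge>0. ln (1 / h x) \<le> c1 * (1 + ln (1 + x) powr (1 + \<kappa>))) \<and>
     integrable lborel (\<lambda>x. \<bar>x\<bar> powr q * h x)"

definition posterior_weight :: "(real \<Rightarrow> real) \<Rightarrow> real \<Rightarrow> nat \<Rightarrow> real \<Rightarrow> real \<Rightarrow> real" where
  "posterior_weight h s n X \<theta> = exp (- (real n * (X - \<theta>)\<^sup>2 / 2)) * h (\<theta> / s)"

definition posterior_coord :: "(real \<Rightarrow> real) \<Rightarrow> real \<Rightarrow> nat \<Rightarrow> real \<Rightarrow> real measure" where
  "posterior_coord h s n X = density lborel
     (\<lambda>\<theta>. ennreal (posterior_weight h s n X \<theta> / integral\<^sup>L lborel (posterior_weight h s n X)))"

definition posterior ::
  "(real \<Rightarrow> real) \<Rightarrow> (nat \<Rightarrow> real) \<Rightarrow> nat \<Rightarrow> (nat \<times> nat \<Rightarrow> real) \<Rightarrow> (nat \<times> nat \<Rightarrow> real) measure" where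
  "posterior h s n X = (\<Pi>\<^sub>M i\<in>wavelet_index. posterior_coord h (s (fst i)) n (X i))"

text \<open>The law of \<open>s * \<zeta>\<close> with \<open>\<zeta>\<close> of density \<open>h\<close>.\<close>

definition prior_coord :: "(real \<Rightarrow> real) \<Rightarrow> real \<Rightarrow> real measure" where
  "prior_coord h s = distr (density lborel (\<lambda>x. ennreal (h x))) borel (\<lambda>z. s * z)"

lemma prior_coord_eq_density:
  assumes [measurable]: "h \<in> borel_measurable borel" and h: "\<And>x. h x > 0" and s: "s > 0"
  shows "prior_coord h s = density lborel (\<lambda>\<theta>. ennreal (h (\<theta> / s) / s))"
proof -
  have "prior_coord h s = density (distr lborel borel ((*) s)) (\<lambda>\<theta>. ennreal (h (\<theta> / s)))"
    using s by (subst density_distr) (auto simp: prior_coord_def)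
  also have "distr lborel borel ((*) s) = density lborel (\<lambda>_. ennreal (inverse s))"
    using lborel_distr_mult[of s] s by simp
  also have "density \<dots> (\<lambda>\<theta>. ennreal (h (\<theta> / s)))
      = density lborel (\<lambda>\<theta>. ennreal (inverse s) * ennreal (h (\<theta> / s)))"
    by (subst density_density_eq) auto
  also have "\<dots> = density lborel (\<lambda>\<theta>. ennreal (h (\<theta> / s) / s))"
    using s h by (intro density_cong) (auto simp: ennreal_mult' [symmetric] divide_inverse mult.commute)
  finally show ?thesis .
qed

text \<open>Bayes' formula: each coordinate of the posterior is the prior reweighted by the normalised
  likelihood.\<close>

lemma posterior_coord_Bayes:
  fixes n :: nat and X :: real
  assumes [measurable]: "h \<in> borel_measurable borel" and h: "\<And>x. h x > 0" and s: "s > 0"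
  defines "lik \<equiv> \<lambda>\<theta>. exp (- (real n * (X - \<theta>)\<^sup>2 / 2))"
  shows "posterior_coord h s n X
    = density (prior_coord h s) (\<lambda>\<theta>. ennreal (lik \<theta> / integral\<^sup>L (prior_coord h s) lik))"
proof -
  have lik [measurable]: "lik \<in> borel_measurable borel" unfolding lik_def by measurable
  have "integral\<^sup>L (prior_coord h s) lik = integral\<^sup>L lborel (\<lambda>\<theta>. (h (\<theta> / s) / s) *\<^sub>R lik \<theta>)"
    unfolding prior_coord_eq_density[OF assms(1) h s]
    using h s by (subst integral_density) (auto intro!: less_imp_le divide_nonneg_pos)
  also have "\<dots> = integral\<^sup>L lborel (\<lambda>\<theta>. posterior_weight h s n X \<theta> / s)"
    by (intro Bochner_Integration.integral_cong) (auto simp: posterior_weight_def lik_def)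
  finally have Z: "integral\<^sup>L (prior_coord h s) lik = integral\<^sup>L lborel (posterior_weight h s n X) / s"
    by simp
  have Z0: "integral\<^sup>L lborel (posterior_weight h s n X) \<ge> 0"
    using h by (intro integral_nonneg_AE) (auto simp: posterior_weight_def less_imp_le)
  have eq: "ennreal (posterior_weight h s n X \<theta> / integral\<^sup>L lborel (posterior_weight h s n X))
     = ennreal (h (\<theta> / s) / s) * ennreal (lik \<theta> / integral\<^sup>L (prior_coord h s) lik)" for \<theta>
    unfolding Z using h[of "\<theta> / s"] s Z0
    by (subst ennreal_mult [symmetric]) (auto simp: posterior_weight_def lik_def mult.commute)
  show ?thesis
    unfolding prior_coord_eq_density[OF assms(1) h s] posterior_coord_def eq
    by (subst density_density_eq) (simp_all add: prior_coord_eq_density[OF assms(1) h s, symmetric])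
qed

text \<open>For bases that are merely measurable the event below, and its posterior probability as a
  function of the data, need not be measurable. Plain \<open>emeasure\<close> and \<open>nn_integral\<close> could
  then be too small, so outer probability and outer expectation are used.\<close>

definition outer_expectation :: "'a measure \<Rightarrow> ('a \<Rightarrow> ennreal) \<Rightarrow> ennreal" where
  "outer_expectation M u =
     (INF v \<in> {v \<in> borel_measurable M. \<forall>x\<in>space M. u x \<le> v x}. \<integral>\<^sup>+x. v x \<partial>M)"

lemma outer_expectation_eq: "u \<in> borel_measurable M \<Longrightarrow> outer_expectation M u = (\<integral>\<^sup>+x. u x \<partial>M)"
  unfolding outer_expectation_def by (rule INF_eqI) (auto intro: nn_integral_mono)

text \<open>\<open>E\<^sub>f\<^sub>0 \<Pi>[{f. \<parallel>f - f\<^sub>0\<parallel>\<^sub>\<infinity> > r} | X]\<close>\<close>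

definition expected_posterior_sup ::
  "(nat \<Rightarrow> nat \<Rightarrow> real \<Rightarrow> real) \<Rightarrow> (real \<Rightarrow> real) \<Rightarrow> (nat \<Rightarrow> real) \<Rightarrow> (real \<Rightarrow> real) \<Rightarrow> nat \<Rightarrow> real \<Rightarrow> ennreal"
where
  "expected_posterior_sup \<psi> h s f0 n r =
     outer_expectation (white_noise (wavelet_coeff \<psi> f0) n)
       (\<lambda>X. outer_measure_of (posterior h s n X)
              {\<theta> \<in> space (posterior h s n X). sup_dist \<psi> \<theta> f0 > ereal r})"

end

theory Submission
  imports Defs "HOL-Real_Asymp.Real_Asymp"
begin

text \<open>By localisation, \<open>\<parallel>f - f\<^sub>0\<parallel>\<^sub>\<infinity> \<le> C \<Sum>\<^sub>l 2\<^bsup>l/2\<^esup> max\<^sub>k \<bar>f\<^sub>l\<^sub>k - f\<^sub>0\<^sub>,\<^sub>l\<^sub>k\<bar>\<close>, so a union bound over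
  the coordinates with suitable thresholds \<open>t\<^sub>l\<close> reduces the theorem to one-dimensional posteriors. Let \<open>J\<close>
  be the cutoff with \<open>2\<^bsup>J(1+2\<beta>)\<^esup> \<approx> n log\<^sup>2 n\<close>. At levels \<open>l < J\<close> the threshold is \<open>n\<^bsup>-1/2\<^esup>\<close> up to a power
  of \<open>log n\<close>: the heavy tail of \<open>h\<close> costs only a factor \<open>exp (polylog n)\<close> of prior mass, which the Gaussian
  likelihood beats. At levels \<open>l \<ge> J\<close> both the signal and the prior scale are below \<open>n\<^bsup>-1/2\<^esup>\<close>, and
  the expected posterior tail is, up to a negligible term, at most a constant times the prior tail, which is controlled by the
  \<open>q\<close>-th moment; the sum over the \<open>2\<^sup>l\<close> coordinates converges because \<open>\<alpha> \<ge> \<beta> + 1 / q\<close>. The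
  threshold there decays slower than the signal by \<open>2\<^bsup>(l-J)\<beta>/2\<^esup>\<close>, which leaves room for this sum even in
  the boundary case.\<close>

section \<open>Gaussian likelihoods and one-dimensional posteriors\<close>

text \<open>The exponential factor is the likelihood ratio of N(\<theta>, 1/n) against N(0, 1/n) at
  \<open>x\<close>. Completing the square shows that multiplying by it shifts the mean from \<mu> to
  \<mu> + \<theta>, up to a constant factor.\<close>

lemma normal_density_tilt:
  fixes n :: nat and \<mu> \<theta> x :: real
  assumes "n > 0"
  shows "normal_density \<mu> (1 / sqrt n) x * exp (n * x * \<theta> - n * \<theta>\<^sup>2 / 2)
       = exp (n * \<mu> * \<theta>) * normal_density (\<mu> + \<theta>) (1 / sqrt n) x"
proof -
  have "- (x - \<mu>)\<^sup>2 * n / 2 + (n * x * \<theta> - n * \<theta>\<^sup>2 / 2) = n * \<mu> * \<theta> - (x - (\<mu> + \<theta>))\<^sup>2 * n / 2"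
    by (simp add: power2_eq_square field_simps)
  then have "exp (- (x - \<mu>)\<^sup>2 * n / 2) * exp (n * x * \<theta> - n * \<theta>\<^sup>2 / 2)
      = exp (n * \<mu> * \<theta>) * exp (- (x - (\<mu> + \<theta>))\<^sup>2 * n / 2)"
    by (simp flip: exp_add)
  then show ?thesis
    using assms by (simp add: normal_density_def power_divide mult.commute mult.left_commute)
qed

text \<open>Serves twice: as the exponential moment behind the Gaussian tail bound, and to average a
  likelihood ratio over the data at a fixed parameter value.\<close>

lemma nn_integral_normal_tilt:
  fixes n :: nat and \<mu> \<theta> :: real
  assumes "n > 0"
  shows "(\<integral>\<^sup>+x. ennreal (exp (n * x * \<theta> - n * \<theta>\<^sup>2 / 2)) \<partial>density lborel (normal_density \<mu> (1 / sqrt n)))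
       = ennreal (exp (n * \<mu> * \<theta>))"
proof -
  have "(\<integral>\<^sup>+x. ennreal (exp (n * x * \<theta> - n * \<theta>\<^sup>2 / 2)) \<partial>density lborel (normal_density \<mu> (1 / sqrt n)))
      = (\<integral>\<^sup>+x. ennreal (normal_density \<mu> (1 / sqrt n) x) * ennreal (exp (n * x * \<theta> - n * \<theta>\<^sup>2 / 2)) \<partial>lborel)"
    by (intro nn_integral_density) auto
  also have "\<dots> = (\<integral>\<^sup>+x. ennreal (exp (n * \<mu> * \<theta>)) * ennreal (normal_density (\<mu> + \<theta>) (1 / sqrt n) x) \<partial>lborel)"
    by (intro nn_integral_cong) (simp add: ennreal_mult[symmetric] normal_density_tilt[OF assms])
  also have "\<dots> = ennreal (exp (n * \<mu> * \<theta>)) * (\<integral>\<^sup>+x. ennreal (normal_density (\<mu> + \<theta>) (1 / sqrt n) x) \<partial>lborel)"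
    by (intro nn_integral_cmult) auto
  also have "(\<integral>\<^sup>+x. ennreal (normal_density (\<mu> + \<theta>) (1 / sqrt n) x) \<partial>lborel) = 1"
    using assms by (subst nn_integral_eq_integral) (auto intro!: integrable_normal_density)
  finally show ?thesis by simp
qed

text \<open>Chernoff's bound with the tilts \<open>b = a\<close> and \<open>b = - a\<close>: then
  \<open>?e b x\<close> is exp (n b (x - \<mu>) - n a^2), which is at least 1 on one of the two
  tails and has expectation exp (- n a^2 / 2).\<close>

lemma normal_tail:
  fixes n :: nat and \<mu> a :: real
  assumes "n > 0" "a \<ge> 0"
  shows "emeasure (density lborel (normal_density \<mu> (1 / sqrt n))) {x. a < \<bar>x - \<mu>\<bar>}
      \<le> ennreal (2 * exp (- (n * a\<^sup>2 / 2)))"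
proof -
  let ?M = "density lborel (normal_density \<mu> (1 / sqrt n))"
  let ?e = "\<lambda>(b :: real) (x :: real). ennreal (exp (- (n * \<mu> * b) - n * a\<^sup>2 / 2)) * ennreal (exp (n * x * b - n * b\<^sup>2 / 2))"
  have chern: "exp (- (n * \<mu> * b) - n * a\<^sup>2 / 2) * exp (n * x * b - n * b\<^sup>2 / 2) \<ge> 1"
    if "a * a \<le> b * (x - \<mu>)" "b * b = a * a" for x b :: real
  proof -
    have "- (n * \<mu> * b) - n * a\<^sup>2 / 2 + (n * x * b - n * b\<^sup>2 / 2) = n * (b * (x - \<mu>) - a * a)"
      using that by (simp add: power2_eq_square algebra_simps)
    also have "\<dots> \<ge> 0" using that by simp
    finally show ?thesis by (simp flip: exp_add)
  qed
  have int_e: "(\<integral>\<^sup>+x. ?e b x \<partial>?M)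
      = ennreal (exp (- (n * \<mu> * b) - n * a\<^sup>2 / 2)) * ennreal (exp (n * \<mu> * b))" for b
    unfolding nn_integral_normal_tilt[OF assms(1), symmetric] by (intro nn_integral_cmult) auto
  have "emeasure ?M {x. a < \<bar>x - \<mu>\<bar>} = (\<integral>\<^sup>+x. indicator {x. a < \<bar>x - \<mu>\<bar>} x \<partial>?M)"
    by (intro nn_integral_indicator[symmetric]) simp
  also have "\<dots> \<le> (\<integral>\<^sup>+x. ?e a x + ?e (- a) x \<partial>?M)"
  proof (intro nn_integral_mono)
    fix x
    show "indicator {x. a < \<bar>x - \<mu>\<bar>} x \<le> ?e a x + ?e (- a) x"
    proof (cases "a < \<bar>x - \<mu>\<bar>")
      case True
      then consider "a \<le> x - \<mu>" | "a \<le> - (x - \<mu>)" by linarith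
      then show ?thesis
      proof cases
        case 1
        then have "1 \<le> ?e a x"
          using chern[of a x] assms(2) by (simp add: mult_left_mono ennreal_mult[symmetric] flip: ennreal_1)
        then show ?thesis using True by (simp add: add_increasing2)
      next
        case 2
        then have "a * a \<le> a * - (x - \<mu>)" using assms(2) by (intro mult_left_mono) auto
        then have "1 \<le> ?e (- a) x"
          using chern[of "- a" x] by (simp add: ennreal_mult[symmetric] algebra_simps flip: ennreal_1)
        then show ?thesis using True by (simp add: add_increasing)
      qed
    qed simp
  qed
  also have "\<dots> = ennreal (exp (- (n * \<mu> * a) - n * a\<^sup>2 / 2)) * ennreal (exp (n * \<mu> * a))
     + ennreal (exp (- (n * \<mu> * (- a)) - n * a\<^sup>2 / 2)) * ennreal (exp (n * \<mu> * (- a)))"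
    by (subst nn_integral_add, measurable) (simp only: int_e)
  also have "\<dots> = ennreal (2 * exp (- (n * a\<^sup>2 / 2)))"
    by (simp add: ennreal_mult[symmetric] ennreal_plus[symmetric] exp_add[symmetric] del: ennreal_plus)
  finally show ?thesis .
qed

text \<open>The logarithmic tail condition and the moment condition are added as hypotheses of
  single lemmas: the first enters at coarse levels, the second at fine levels.\<close>

locale even_density =
  fixes h :: "real \<Rightarrow> real"
  assumes h_measurable [measurable]: "h \<in> borel_measurable borel"
    and h_integrable: "integrable lborel h"
    and h_integral: "integral\<^sup>L lborel h = 1"
    and h_even: "h (- x) = h x"
    and h_pos: "h x > 0"
    and h_antimono: "antimono_on {0..} h"
begin

lemma h_le: "\<bar>x\<bar> \<le> y \<Longrightarrow> h y \<le> h x"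
  using monotone_onD[OF h_antimono, of "\<bar>x\<bar>" y] h_even[of x] by (cases "x \<ge> 0") auto

lemma nn_integral_rescale:
  assumes "s > 0" and [measurable]: "g \<in> borel_measurable borel"
  shows "(\<integral>\<^sup>+\<theta>. g (\<theta> / s) \<partial>lborel) = ennreal s * (\<integral>\<^sup>+z. g z \<partial>lborel)"
  using assms by (subst nn_integral_real_affine[where c = s and t = 0]) auto

lemma nn_integral_h: "(\<integral>\<^sup>+z. ennreal (h z) \<partial>lborel) = 1"
  using h_pos by (subst nn_integral_eq_integral) (auto simp: h_integrable h_integral less_imp_le)

lemma posterior_weight_measurable [measurable]:
  "(\<lambda>(X, \<theta>). posterior_weight h s n X \<theta>) \<in> borel_measurable (borel \<Otimes>\<^sub>M borel)"
  unfolding posterior_weight_def by measurable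

lemma posterior_weight_measurable' [measurable]:
  "posterior_weight h s n X \<in> borel_measurable borel"
  unfolding posterior_weight_def by measurable

lemma posterior_weight_pos: "posterior_weight h s n X \<theta> > 0"
  using h_pos by (simp add: posterior_weight_def)

lemma posterior_weight_integrable:
  assumes "s > 0"
  shows "integrable lborel (posterior_weight h s n X)"
proof (rule Bochner_Integration.integrable_bound)
  show "integrable lborel (\<lambda>\<theta>. h (\<theta> / s))"
    using lborel_integrable_real_affine[OF h_integrable, of "1 / s" 0] assms by simp
  show "AE \<theta> in lborel. norm (posterior_weight h s n X \<theta>) \<le> norm (h (\<theta> / s))"
    using h_pos by (auto simp: posterior_weight_def abs_mult intro!: AE_I2 mult_left_le_one_le)
qed simp

text \<open>All lower bounds on the normalising constant, the denominator in Bayes' formula, come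
  from keeping only one interval of parameter values.\<close>

lemma posterior_weight_integral_ge:
  assumes "s > 0" "c \<ge> 0" "a \<le> b" "\<And>\<theta>. a \<le> \<theta> \<Longrightarrow> \<theta> \<le> b \<Longrightarrow> c \<le> posterior_weight h s n X \<theta>"
  shows "c * (b - a) \<le> integral\<^sup>L lborel (posterior_weight h s n X)"
proof -
  have "c * (b - a) = integral\<^sup>L lborel (\<lambda>\<theta>. c * indicator {a..b} \<theta>)"
    using assms by simp
  also have "\<dots> \<le> integral\<^sup>L lborel (posterior_weight h s n X)"
    using assms posterior_weight_pos[of s n X]
    by (intro integral_mono posterior_weight_integrable integrable_mult_right integrable_real_indicator)
       (auto simp: indicator_def less_imp_le)
  finally show ?thesis .
qed

lemma posterior_weight_integral_pos:
  assumes "s > 0"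
  shows "integral\<^sup>L lborel (posterior_weight h s n X) > 0"
proof -
  \<comment> \<open>On [0, 1] the distance from \<theta> to \<open>X\<close> is at most |X| + 1, and
    \<theta> / s is at most 1 / s.\<close>
  let ?c = "exp (- (n * (\<bar>X\<bar> + 1)\<^sup>2 / 2)) * h (1 / s)"
  have "?c * (1 - 0) \<le> integral\<^sup>L lborel (posterior_weight h s n X)"
  proof (rule posterior_weight_integral_ge[OF assms])
    fix \<theta> :: real assume "0 \<le> \<theta>" "\<theta> \<le> 1"
    then show "?c \<le> posterior_weight h s n X \<theta>"
      unfolding posterior_weight_def using assms h_pos
      by (intro mult_mono h_le)
         (auto simp: divide_right_mono less_imp_le intro!: mult_left_mono abs_le_square_iff[THEN iffD1])
  qed (use h_pos in \<open>auto simp: less_imp_le\<close>)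
  moreover have "?c > 0" using h_pos by simp
  ultimately show ?thesis by simp
qed

lemma sets_posterior_coord [measurable_cong, simp]: "sets (posterior_coord h s n X) = sets borel"
  by (simp add: posterior_coord_def)

lemma space_posterior_coord [simp]: "space (posterior_coord h s n X) = UNIV"
  by (simp add: posterior_coord_def)

lemma emeasure_posterior_coord:
  assumes "s > 0" "A \<in> sets borel"
  shows "emeasure (posterior_coord h s n X) A =
    (\<integral>\<^sup>+\<theta>. ennreal (posterior_weight h s n X \<theta>) * indicator A \<theta> \<partial>lborel)
      / ennreal (integral\<^sup>L lborel (posterior_weight h s n X))"
proof -
  let ?D = "integral\<^sup>L lborel (posterior_weight h s n X)"
  have "emeasure (posterior_coord h s n X) A
      = (\<integral>\<^sup>+\<theta>. ennreal (posterior_weight h s n X \<theta> / ?D) * indicator A \<theta> \<partial>lborel)"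
    using assms unfolding posterior_coord_def by (intro emeasure_density) auto
  also have "\<dots> = (\<integral>\<^sup>+\<theta>. ennreal (posterior_weight h s n X \<theta>) * indicator A \<theta> / ennreal ?D \<partial>lborel)"
    using posterior_weight_integral_pos[OF assms(1), of n X] posterior_weight_pos[of s n X]
    by (intro nn_integral_cong) (auto simp: divide_ennreal less_imp_le indicator_def)
  also have "\<dots> = (\<integral>\<^sup>+\<theta>. ennreal (posterior_weight h s n X \<theta>) * indicator A \<theta> \<partial>lborel) / ennreal ?D"
    using assms by (intro nn_integral_divide) auto
  finally show ?thesis .
qed

lemma prob_space_posterior_coord:
  assumes "s > 0"
  shows "prob_space (posterior_coord h s n X)"
proof
  have "(\<integral>\<^sup>+\<theta>. ennreal (posterior_weight h s n X \<theta>) \<partial>lborel)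
      = ennreal (integral\<^sup>L lborel (posterior_weight h s n X))"
    using posterior_weight_pos[of s n X]
    by (intro nn_integral_eq_integral posterior_weight_integrable[OF assms]) (auto simp: less_imp_le)
  then show "emeasure (posterior_coord h s n X) (space (posterior_coord h s n X)) = 1"
    using posterior_weight_integral_pos[OF assms, of n X]
    by (simp add: emeasure_posterior_coord[OF assms] divide_ennreal)
qed

lemma posterior_coord_measurable [measurable]:
  assumes "s > 0" and [measurable]: "A \<in> sets borel"
  shows "(\<lambda>X. emeasure (posterior_coord h s n X) A) \<in> borel_measurable borel"
proof -
  have [measurable]: "(\<lambda>(X, \<theta>). posterior_weight h s n X \<theta>) \<in> borel_measurable (borel \<Otimes>\<^sub>M lborel)"
    by simp
  show ?thesis
    unfolding emeasure_posterior_coord[OF assms] by measurable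
qed

text \<open>Separates numerator and denominator: after this only the unnormalised weight of
  \<open>A\<close> has to be bounded.\<close>

lemma emeasure_posterior_coord_le:
  assumes "s > 0" "A \<in> sets borel" "d > 0" "d \<le> integral\<^sup>L lborel (posterior_weight h s n X)"
  shows "emeasure (posterior_coord h s n X) A \<le>
    ennreal (1 / d) * (\<integral>\<^sup>+\<theta>. ennreal (posterior_weight h s n X \<theta>) * indicator A \<theta> \<partial>lborel)"
proof -
  have "emeasure (posterior_coord h s n X) A
      \<le> (\<integral>\<^sup>+\<theta>. ennreal (posterior_weight h s n X \<theta>) * indicator A \<theta> \<partial>lborel) / ennreal d"
    unfolding emeasure_posterior_coord[OF assms(1,2)]
    unfolding divide_ennreal_def using assms
    by (intro mult_left_mono) (auto simp: inverse_ennreal ennreal_leI le_imp_inverse_le)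
  also have "\<dots> = ennreal (1 / d) * (\<integral>\<^sup>+\<theta>. ennreal (posterior_weight h s n X \<theta>) * indicator A \<theta> \<partial>lborel)"
    using assms(3) by (simp add: ennreal_divide_times divide_ennreal_def inverse_ennreal inverse_eq_divide mult.commute)
  finally show ?thesis .
qed

end

section \<open>Reduction to one-dimensional posteriors\<close>

text \<open>By localisation, level \<open>l\<close> of the difference is at most
  \<open>C * 2 powr (l / 2) * t l\<close> uniformly on [0, 1]. The statement is deterministic and
  includes pointwise convergence of the series of \<open>\<theta>\<close>, so the infinite default
  in \<open>sup_dist\<close> does not occur.\<close>

lemma sup_dist_le:
  assumes loc: "\<And>l x. x \<in> {0..1} \<Longrightarrow> (\<Sum>k<2 ^ l. \<bar>\<psi> l k x\<bar>) \<le> C * 2 powr (real l / 2)"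
    and f0: "\<And>x. x \<in> {0..1} \<Longrightarrow> (\<lambda>l. wavelet_level \<psi> \<theta>0 l x) sums f0 x"
    and t: "summable (\<lambda>l. C * 2 powr (real l / 2) * t l)" "(\<Sum>l. C * 2 powr (real l / 2) * t l) \<le> r"
    and close: "\<And>l k. k < 2 ^ l \<Longrightarrow> \<bar>\<theta> (l, k) - \<theta>0 (l, k)\<bar> \<le> t l"
  shows "sup_dist \<psi> \<theta> f0 \<le> ereal r"
proof -
  have *: "summable (\<lambda>l. wavelet_level \<psi> \<theta> l x) \<and> \<bar>(\<Sum>l. wavelet_level \<psi> \<theta> l x) - f0 x\<bar> \<le> r"
    if x: "x \<in> {0..1}" for x
  proof -
    define \<Delta> where "\<Delta> l = wavelet_level \<psi> \<theta> l x - wavelet_level \<psi> \<theta>0 l x" for l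
    have \<Delta>_le: "\<bar>\<Delta> l\<bar> \<le> C * 2 powr (real l / 2) * t l" for l
    proof -
      \<comment> \<open>Every level contains the index k = 0, so closeness forces the threshold to
        be nonnegative.\<close>
      have "t l \<ge> 0" using close[of 0 l] abs_ge_zero[of "\<theta> (l, 0) - \<theta>0 (l, 0)"] by simp
      have "\<bar>\<Delta> l\<bar> = \<bar>\<Sum>k<2 ^ l. (\<theta> (l, k) - \<theta>0 (l, k)) * \<psi> l k x\<bar>"
        by (simp add: \<Delta>_def wavelet_level_def sum_subtractf left_diff_distrib)
      also have "\<dots> \<le> (\<Sum>k<2 ^ l. \<bar>(\<theta> (l, k) - \<theta>0 (l, k)) * \<psi> l k x\<bar>)" by (rule sum_abs)
      also have "\<dots> \<le> (\<Sum>k<2 ^ l. t l * \<bar>\<psi> l k x\<bar>)"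
        unfolding abs_mult using close by (intro sum_mono mult_right_mono) auto
      also have "\<dots> \<le> t l * (C * 2 powr (real l / 2))"
        unfolding sum_distrib_left[symmetric] using loc[OF x] \<open>t l \<ge> 0\<close> by (intro mult_left_mono)
      finally show ?thesis by (simp add: mult.commute)
    qed
    have sum\<Delta>: "summable (\<lambda>l. \<bar>\<Delta> l\<bar>)"
      using \<Delta>_le by (intro summable_comparison_test'[OF t(1)]) auto
    \<comment> \<open>Convergence for \<open>\<theta>\<close> is obtained by adding an absolutely
      convergent difference to the convergent series of \<open>f0\<close>.\<close>
    from sums_add[OF summable_sums[OF summable_rabs_cancel[OF this]] f0[OF x]]
    have *: "(\<lambda>l. wavelet_level \<psi> \<theta> l x) sums (suminf \<Delta> + f0 x)"
      by (simp add: \<Delta>_def[abs_def])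
    have "\<bar>suminf \<Delta>\<bar> \<le> (\<Sum>l. \<bar>\<Delta> l\<bar>)" using sum\<Delta> by (rule summable_rabs)
    also have "\<dots> \<le> (\<Sum>l. C * 2 powr (real l / 2) * t l)"
      using \<Delta>_le sum\<Delta> t(1) by (intro suminf_le)
    also have "\<dots> \<le> r" by (rule t(2))
    finally show ?thesis using sums_summable[OF *] sums_unique[OF *] by simp
  qed
  then show ?thesis by (auto simp: sup_dist_def intro!: SUP_least)
qed

context even_density
begin

text \<open>A sup-norm distance above \<open>r\<close> forces some coordinate past its threshold,
  and the union bound charges level \<open>l\<close> with 2^l coordinates. Only the one-dimensional
  marginals of posterior and data remain.\<close>

lemma expected_posterior_sup_le:
  fixes n :: nat and t :: "nat \<Rightarrow> real" and g :: "nat \<Rightarrow> ennreal"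
  assumes n: "n > 0" and s: "\<And>l. s l > 0"
    and loc: "\<And>l x. x \<in> {0..1} \<Longrightarrow> (\<Sum>k<2 ^ l. \<bar>\<psi> l k x\<bar>) \<le> C * 2 powr (real l / 2)"
    and f0: "\<And>x. x \<in> {0..1} \<Longrightarrow> (\<lambda>l. wavelet_level \<psi> (wavelet_coeff \<psi> f0) l x) sums f0 x"
    and t: "summable (\<lambda>l. C * 2 powr (real l / 2) * t l)" "(\<Sum>l. C * 2 powr (real l / 2) * t l) \<le> r"
    and g: "\<And>l k. k < 2 ^ l \<Longrightarrow>
      (\<integral>\<^sup>+x. emeasure (posterior_coord h (s l) n x) {\<theta>. t l < \<bar>\<theta> - wavelet_coeff \<psi> f0 (l, k)\<bar>}
        \<partial>density lborel (normal_density (wavelet_coeff \<psi> f0 (l, k)) (1 / sqrt (real n)))) \<le> g l"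
  shows "expected_posterior_sup \<psi> h s f0 n r \<le> (\<Sum>l. 2 ^ l * g l)"
proof -
  let ?\<theta>0 = "wavelet_coeff \<psi> f0"
  let ?N = "\<lambda>i. density lborel (normal_density (?\<theta>0 i) (1 / sqrt (real n)))"
  let ?W = "white_noise ?\<theta>0 n"
  let ?A = "\<lambda>l k. {\<theta>. t l < \<bar>\<theta> - ?\<theta>0 (l, k)\<bar>}"
  let ?E = "\<lambda>x l k. emeasure (posterior_coord h (s l) n x) (?A l k)"
  \<comment> \<open>A measurable majorant of the outer posterior probability, hence admissible in
    the infimum that defines \<open>outer_expectation\<close>.\<close>
  define v where "v X = (\<Sum>l. \<Sum>k<2 ^ l. ?E (X (l, k)) l k)" for X
  have idx: "(l, k) \<in> wavelet_index" if "k < 2 ^ l" for l k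
    using that by (auto simp: wavelet_index_def)
  have A [measurable]: "?A l k \<in> sets borel" for l k by measurable
  have E [measurable]: "(\<lambda>x. ?E x l k) \<in> borel_measurable borel" for l k
    by (rule posterior_coord_measurable[OF s A])
  have N: "prob_space (?N i)" for i using n by (intro prob_space_normal_density) simp
  have comp: "(\<lambda>X. X (l, k)) \<in> measurable ?W (?N (l, k))" if "k < 2 ^ l" for l k
    unfolding white_noise_def by (rule measurable_component_singleton[OF idx[OF that]])
  have comp': "(\<lambda>X. X (l, k)) \<in> borel_measurable ?W" if "k < 2 ^ l" for l k
    using comp[OF that] by (simp cong: measurable_cong_sets)
  have EX: "(\<lambda>X. ?E (X (l, k)) l k) \<in> borel_measurable ?W" if "k < 2 ^ l" for l k
    by (rule measurable_compose[OF comp'[OF that] E])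
  have EXs [measurable]: "(\<lambda>X. \<Sum>k<2 ^ l. ?E (X (l, k)) l k) \<in> borel_measurable ?W" for l
    using EX by (intro borel_measurable_sum) auto
  have v: "v \<in> borel_measurable ?W"
    unfolding v_def by measurable
  \<comment> \<open>The integrand depends on one component of the data, whose law under the product
    measure is the corresponding normal factor.\<close>
  have marg: "(\<integral>\<^sup>+X. ?E (X (l, k)) l k \<partial>?W) \<le> g l" if k: "k < 2 ^ l" for l k
  proof -
    have "(\<integral>\<^sup>+X. ?E (X (l, k)) l k \<partial>?W) = (\<integral>\<^sup>+x. ?E x l k \<partial>distr ?W (?N (l, k)) (\<lambda>X. X (l, k)))"
      by (rule nn_integral_distr[OF comp[OF k], symmetric]) simp
    also have "distr ?W (?N (l, k)) (\<lambda>X. X (l, k)) = ?N (l, k)"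
      unfolding white_noise_def using N idx[OF k] by (rule distr_PiM_component)
    finally show ?thesis using g[OF k] by simp
  qed
  have bound: "outer_measure_of (posterior h s n X)
      {\<theta> \<in> space (posterior h s n X). sup_dist \<psi> \<theta> f0 > ereal r} \<le> v X" for X
  proof -
    let ?P = "posterior h s n X"
    let ?Q = "\<lambda>i. posterior_coord h (s (fst i)) n (X i)"
    let ?B = "\<lambda>l k. {\<theta> \<in> space ?P. \<theta> (l, k) \<in> ?A l k}"
    have Q: "prob_space (?Q i)" for i by (rule prob_space_posterior_coord[OF s])
    have compQ: "(\<lambda>\<theta>. \<theta> (l, k)) \<in> measurable ?P (?Q (l, k))" if "k < 2 ^ l" for l k
      unfolding posterior_def by (rule measurable_component_singleton[OF idx[OF that]])
    have B: "?B l k \<in> sets ?P" if k: "k < 2 ^ l" for l k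
      using measurable_sets[OF compQ[OF k], of "?A l k"] by (simp add: vimage_def Int_def conj_commute)
    have emB: "emeasure ?P (?B l k) = ?E (X (l, k)) l k" if k: "k < 2 ^ l" for l k
    proof -
      have "?E (X (l, k)) l k = emeasure (distr ?P (?Q (l, k)) (\<lambda>\<theta>. \<theta> (l, k))) (?A l k)"
        unfolding posterior_def using distr_PiM_component[of wavelet_index ?Q, OF Q idx[OF k]] by simp
      also have "\<dots> = emeasure ?P ((\<lambda>\<theta>. \<theta> (l, k)) -` ?A l k \<inter> space ?P)"
        by (rule emeasure_distr[OF compQ[OF k]]) simp
      also have "(\<lambda>\<theta>. \<theta> (l, k)) -` ?A l k \<inter> space ?P = ?B l k" by auto
      finally show ?thesis by simp
    qed
    have Bl: "(\<Union>k<2 ^ l. ?B l k) \<in> sets ?P" for l using B by auto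
    \<comment> \<open>Contraposition of \<open>sup_dist_le\<close>. The covering union is measurable
      even if the covered event is not, so its outer measure is its measure.\<close>
    have "{\<theta> \<in> space ?P. sup_dist \<psi> \<theta> f0 > ereal r} \<subseteq> (\<Union>l. \<Union>k<2 ^ l. ?B l k)"
    proof (rule ccontr)
      assume "\<not> ?thesis"
      then obtain \<theta> where "sup_dist \<psi> \<theta> f0 > ereal r" "\<theta> \<in> space ?P" "\<And>l k. k < 2 ^ l \<Longrightarrow> \<theta> \<notin> ?B l k"
        by blast
      then have "sup_dist \<psi> \<theta> f0 > ereal r" "\<And>l k. k < 2 ^ l \<Longrightarrow> \<bar>\<theta> (l, k) - ?\<theta>0 (l, k)\<bar> \<le> t l"
        by (auto simp: not_less)
      with sup_dist_le[of \<psi> C ?\<theta>0 f0 t r \<theta>, OF loc f0 t] show False by auto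
    qed
    then have "outer_measure_of ?P {\<theta> \<in> space ?P. sup_dist \<psi> \<theta> f0 > ereal r}
        \<le> outer_measure_of ?P (\<Union>l. \<Union>k<2 ^ l. ?B l k)"
      by (rule outer_measure_of_mono)
    also have "\<dots> = emeasure ?P (\<Union>l. \<Union>k<2 ^ l. ?B l k)"
      using Bl by (intro outer_measure_of_eq sets.countable_UN) auto
    also have "\<dots> \<le> (\<Sum>l. emeasure ?P (\<Union>k<2 ^ l. ?B l k))"
      using Bl by (intro emeasure_subadditive_countably) auto
    also have "\<dots> \<le> (\<Sum>l. \<Sum>k<2 ^ l. emeasure ?P (?B l k))"
      using B by (intro suminf_le emeasure_subadditive_finite) auto
    also have "\<dots> = v X" unfolding v_def using emB by (intro suminf_cong sum.cong) auto
    finally show ?thesis .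
  qed
  have "expected_posterior_sup \<psi> h s f0 n r \<le> (\<integral>\<^sup>+X. v X \<partial>?W)"
    unfolding expected_posterior_sup_def outer_expectation_def
    using v bound by (intro INF_lower) auto
  also have "\<dots> = (\<Sum>l. \<integral>\<^sup>+X. (\<Sum>k<2 ^ l. ?E (X (l, k)) l k) \<partial>?W)"
    unfolding v_def using EXs by (intro nn_integral_suminf)
  also have "\<dots> = (\<Sum>l. \<Sum>k<2 ^ l. \<integral>\<^sup>+X. ?E (X (l, k)) l k \<partial>?W)"
    using EX by (intro suminf_cong nn_integral_sum) auto
  also have "\<dots> \<le> (\<Sum>l. 2 ^ l * g l)"
  proof (intro suminf_le)
    fix l
    have "(\<Sum>k<2 ^ l. \<integral>\<^sup>+X. ?E (X (l, k)) l k \<partial>?W) \<le> (\<Sum>k<(2 ^ l :: nat). g l)"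
      using marg by (intro sum_mono) auto
    then show "(\<Sum>k<2 ^ l. \<integral>\<^sup>+X. ?E (X (l, k)) l k \<partial>?W) \<le> 2 ^ l * g l" by simp
  qed auto
  finally show ?thesis .
qed

end

section \<open>Tails of one-dimensional posteriors\<close>

context even_density
begin

text \<open>The denominator is restricted to |\<theta> - \<mu>| \<le> 1 / sqrt n, where the exponent
  is at least - (1 + T/4)^2 / 2 and the prior factor at least \<open>h ((F + 1) / s)\<close>. In the
  numerator |x - \<theta>| is at least 3 T / (4 sqrt n), which gives exp (- 9 T^2 / 32). The two
  exponents combine to 1/2 + T/4 - T^2/4.\<close>

lemma posterior_coord_concentration:
  fixes n :: nat
  assumes n: "n > 0" and s: "s > 0" and F: "\<bar>\<mu>\<bar> \<le> F" and T: "T \<ge> 0"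
    and x: "\<bar>x - \<mu>\<bar> \<le> T / (4 * sqrt n)"
  shows "emeasure (posterior_coord h s n x) {\<theta>. T / sqrt n < \<bar>\<theta> - \<mu>\<bar>}
    \<le> ennreal (exp (1 / 2 + T / 4 - T\<^sup>2 / 4) * (s * sqrt n) / (2 * h ((F + 1) / s)))"
proof -
  let ?A = "{\<theta>. T / sqrt n < \<bar>\<theta> - \<mu>\<bar>}"
  let ?c = "exp (- ((1 + T / 4)\<^sup>2 / 2)) * h ((F + 1) / s)"
  let ?d = "?c * (2 / sqrt n)"
  have sn: "sqrt n > 0" "1 / sqrt n \<le> 1" using n by auto
  have nsq: "n * y\<^sup>2 = (sqrt n * \<bar>y\<bar>)\<^sup>2" for y :: real by (simp add: power_mult_distrib)
  have x': "sqrt n * \<bar>x - \<mu>\<bar> \<le> T / 4" using x sn by (simp add: field_simps)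
  have "?c * ((\<mu> + 1 / sqrt n) - (\<mu> - 1 / sqrt n)) \<le> integral\<^sup>L lborel (posterior_weight h s n x)"
  proof (rule posterior_weight_integral_ge[OF s])
    fix \<theta> assume \<theta>: "\<mu> - 1 / sqrt n \<le> \<theta>" "\<theta> \<le> \<mu> + 1 / sqrt n"
    then have "\<bar>\<theta> - \<mu>\<bar> \<le> 1 / sqrt n" by auto
    then have "sqrt n * \<bar>\<theta> - \<mu>\<bar> \<le> 1" using sn by (simp add: field_simps)
    moreover have "sqrt n * \<bar>x - \<theta>\<bar> \<le> sqrt n * \<bar>x - \<mu>\<bar> + sqrt n * \<bar>\<theta> - \<mu>\<bar>"
      unfolding distrib_left[symmetric] using sn by (intro mult_left_mono) auto
    ultimately have "sqrt n * \<bar>x - \<theta>\<bar> \<le> 1 + T / 4" using x' by linarith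
    then have "n * (x - \<theta>)\<^sup>2 \<le> (1 + T / 4)\<^sup>2"
      unfolding nsq using sn by (intro power_mono) auto
    moreover have "\<bar>\<theta>\<bar> \<le> F + 1" using \<theta> F sn(2) by linarith
    ultimately show "?c \<le> posterior_weight h s n x \<theta>"
      unfolding posterior_weight_def using s h_pos
      by (intro mult_mono h_le) (auto simp: divide_right_mono less_imp_le)
  qed (use sn h_pos in \<open>auto simp: less_imp_le\<close>)
  then have d: "?d \<le> integral\<^sup>L lborel (posterior_weight h s n x)" by (simp add: algebra_simps)
  have "(\<integral>\<^sup>+\<theta>. ennreal (posterior_weight h s n x \<theta>) * indicator ?A \<theta> \<partial>lborel)
      \<le> (\<integral>\<^sup>+\<theta>. ennreal (exp (- (9 * T\<^sup>2 / 32))) * ennreal (h (\<theta> / s)) \<partial>lborel)"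
  proof (intro nn_integral_mono)
    fix \<theta>
    show "ennreal (posterior_weight h s n x \<theta>) * indicator ?A \<theta>
      \<le> ennreal (exp (- (9 * T\<^sup>2 / 32))) * ennreal (h (\<theta> / s))"
    proof (cases "\<theta> \<in> ?A")
      case True
      then have "T \<le> sqrt n * \<bar>\<theta> - \<mu>\<bar>" using sn by (simp add: field_simps)
      moreover have "sqrt n * \<bar>\<theta> - \<mu>\<bar> \<le> sqrt n * \<bar>x - \<mu>\<bar> + sqrt n * \<bar>x - \<theta>\<bar>"
        unfolding distrib_left[symmetric] using sn by (intro mult_left_mono) auto
      ultimately have "3 * T / 4 \<le> sqrt n * \<bar>x - \<theta>\<bar>" using x' by linarith
      then have "(3 * T / 4)\<^sup>2 \<le> n * (x - \<theta>)\<^sup>2"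
        unfolding nsq using T by (intro power_mono) auto
      then have "posterior_weight h s n x \<theta> \<le> exp (- (9 * T\<^sup>2 / 32)) * h (\<theta> / s)"
        unfolding posterior_weight_def using h_pos
        by (intro mult_right_mono) (auto simp: less_imp_le power_mult_distrib power_divide)
      then show ?thesis using True h_pos by (auto simp: ennreal_mult[symmetric] less_imp_le intro!: ennreal_leI)
    qed simp
  qed
  also have "\<dots> = ennreal (exp (- (9 * T\<^sup>2 / 32)) * s)"
    using nn_integral_rescale[of s "\<lambda>z. ennreal (h z)"] s
    by (simp add: nn_integral_cmult nn_integral_h ennreal_mult[symmetric])
  finally have N: "(\<integral>\<^sup>+\<theta>. ennreal (posterior_weight h s n x \<theta>) * indicator ?A \<theta> \<partial>lborel)
      \<le> ennreal (exp (- (9 * T\<^sup>2 / 32)) * s)" .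
  have d0: "?d > 0" using h_pos sn by simp
  have A: "?A \<in> sets borel" by measurable
  have "emeasure (posterior_coord h s n x) ?A
    \<le> ennreal (1 / ?d) * (\<integral>\<^sup>+\<theta>. ennreal (posterior_weight h s n x \<theta>) * indicator ?A \<theta> \<partial>lborel)"
    by (rule emeasure_posterior_coord_le[OF s A d0 d])
  also have "\<dots> \<le> ennreal (1 / ?d) * ennreal (exp (- (9 * T\<^sup>2 / 32)) * s)"
    using N by (intro mult_left_mono) auto
  also have "\<dots> = ennreal (1 / ?d * (exp (- (9 * T\<^sup>2 / 32)) * s))"
    using d0 s by (intro ennreal_mult[symmetric] less_imp_le[OF divide_pos_pos] mult_nonneg_nonneg) auto
  also have "1 / ?d * (exp (- (9 * T\<^sup>2 / 32)) * s)
    = (exp ((1 + T / 4)\<^sup>2 / 2) * exp (- (9 * T\<^sup>2 / 32))) * (s * sqrt n) / (2 * h ((F + 1) / s))"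
    using sn h_pos[of "(F + 1) / s"] by (simp add: exp_minus field_simps)
  also have "exp ((1 + T / 4)\<^sup>2 / 2) * exp (- (9 * T\<^sup>2 / 32)) = exp (1 / 2 + T / 4 - T\<^sup>2 / 4)"
    by (simp add: exp_add[symmetric] power2_eq_square field_simps)
  finally show ?thesis .
qed

text \<open>On the event \<open>?G\<close> of atypical data the posterior probability is bounded by
  1, and the normal tail at T / (4 sqrt n) gives the exponent T^2 / 32; off \<open>?G\<close> the
  pointwise bound applies.\<close>

lemma expected_posterior_coord_coarse:
  fixes n :: nat
  assumes n: "n > 0" and s: "s > 0" and F: "\<bar>\<mu>\<bar> \<le> F" and T: "T \<ge> 0"
  shows "(\<integral>\<^sup>+x. emeasure (posterior_coord h s n x) {\<theta>. T / sqrt n < \<bar>\<theta> - \<mu>\<bar>}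
      \<partial>density lborel (normal_density \<mu> (1 / sqrt n)))
    \<le> ennreal (2 * exp (- (T\<^sup>2 / 32))
        + exp (1 / 2 + T / 4 - T\<^sup>2 / 4) * (s * sqrt n) / (2 * h ((F + 1) / s)))"
proof -
  let ?A = "{\<theta>. T / sqrt n < \<bar>\<theta> - \<mu>\<bar>}"
  let ?M = "density lborel (normal_density \<mu> (1 / sqrt n))"
  let ?G = "{x. T / (4 * sqrt n) < \<bar>x - \<mu>\<bar>}"
  let ?R = "exp (1 / 2 + T / 4 - T\<^sup>2 / 4) * (s * sqrt n) / (2 * h ((F + 1) / s))"
  interpret prob_space ?M using n by (intro prob_space_normal_density) simp
  have G: "?G \<in> sets borel" by measurable
  have "emeasure (posterior_coord h s n x) ?A \<le> indicator ?G x + ennreal ?R" for x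
  proof (cases "x \<in> ?G")
    case True
    interpret P: prob_space "posterior_coord h s n x" by (rule prob_space_posterior_coord[OF s])
    show ?thesis using True P.emeasure_le_1[of ?A] by (simp add: add_increasing2)
  next
    case False
    then show ?thesis using posterior_coord_concentration[OF n s F T] by (simp add: not_less)
  qed
  then have "(\<integral>\<^sup>+x. emeasure (posterior_coord h s n x) ?A \<partial>?M) \<le> (\<integral>\<^sup>+x. indicator ?G x + ennreal ?R \<partial>?M)"
    by (intro nn_integral_mono)
  also have "\<dots> = emeasure ?M ?G + ennreal ?R"
    using G emeasure_space_1 by (subst nn_integral_add) auto
  also have "emeasure ?M ?G \<le> ennreal (2 * exp (- (T\<^sup>2 / 32)))"
    using normal_tail[OF n, of "T / (4 * sqrt n)" \<mu>] T n
    by (simp add: power_divide power_mult_distrib)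
  finally show ?thesis
    using s h_pos[of "(F + 1) / s"] by (subst ennreal_plus) auto
qed

text \<open>Half of the prior's central interval [-s, s] suffices, namely the half on which \<theta>
  has the sign of \<open>x\<close>, since there (x - \<theta>)^2 \<le> x^2 + \<theta>^2. The factor
  exp (- n x^2 / 2) is kept because the numerator carries the same one.\<close>

lemma posterior_weight_integral_ge_central:
  fixes n :: nat and s x :: real
  assumes s: "s > 0" "n * s\<^sup>2 \<le> 1"
  shows "exp (- (n * x\<^sup>2 / 2)) * (exp (- 1 / 2) * h 1 * s) \<le> integral\<^sup>L lborel (posterior_weight h s n x)"
proof -
  let ?c = "exp (- (n * x\<^sup>2 / 2)) * exp (- 1 / 2) * h 1"
  have *: "?c \<le> posterior_weight h s n x \<theta>" if "\<bar>\<theta>\<bar> \<le> s" "0 \<le> x * \<theta>" for \<theta>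
  proof -
    have "(x - \<theta>)\<^sup>2 \<le> x\<^sup>2 + \<theta>\<^sup>2" using that(2) by (simp add: power2_diff mult.commute)
    also have "\<theta>\<^sup>2 \<le> s\<^sup>2" using that(1) power_mono[of "\<bar>\<theta>\<bar>" s 2] by simp
    finally have "n * (x - \<theta>)\<^sup>2 \<le> n * x\<^sup>2 + n * s\<^sup>2"
      by (simp add: distrib_left[symmetric] mult_left_mono)
    then have "exp (- (n * x\<^sup>2 / 2)) * exp (- 1 / 2) \<le> exp (- (n * (x - \<theta>)\<^sup>2 / 2))"
      using s(2) by (simp add: exp_add[symmetric])
    then show ?thesis
      unfolding posterior_weight_def using s(1) that(1) h_pos
      by (intro mult_mono h_le) (auto simp: less_imp_le)
  qed
  have "?c * s \<le> integral\<^sup>L lborel (posterior_weight h s n x)"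
  proof (cases "x \<ge> 0")
    case True
    have "?c * (s - 0) \<le> integral\<^sup>L lborel (posterior_weight h s n x)"
      using s h_pos[of 1] True by (intro posterior_weight_integral_ge *) auto
    then show ?thesis by simp
  next
    case False
    have "?c * (0 - (- s)) \<le> integral\<^sup>L lborel (posterior_weight h s n x)"
      using s h_pos[of 1] False by (intro posterior_weight_integral_ge *) (auto simp: mult_nonpos_nonpos)
    then show ?thesis by simp
  qed
  then show ?thesis by (simp add: mult.assoc)
qed

text \<open>Markov's inequality for the \<open>q\<close>-th moment. The leading factor
  \<open>s\<close> appears because \<open>h (\<theta> / s)\<close> is not divided by
  \<open>s\<close>.\<close>

lemma prior_tail:
  assumes s: "s > 0" and t: "t > 0" and q: "q > 0"
    and mom: "integrable lborel (\<lambda>z. \<bar>z\<bar> powr q * h z)"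
  shows "(\<integral>\<^sup>+\<theta>. ennreal (h (\<theta> / s)) * indicator {\<theta>. t < \<bar>\<theta>\<bar>} \<theta> \<partial>lborel)
    \<le> ennreal (s * (s / t) powr q * (\<integral>z. \<bar>z\<bar> powr q * h z \<partial>lborel))"
proof -
  have "(\<integral>\<^sup>+\<theta>. ennreal (h (\<theta> / s)) * indicator {\<theta>. t < \<bar>\<theta>\<bar>} \<theta> \<partial>lborel)
      \<le> (\<integral>\<^sup>+\<theta>. ennreal ((s / t) powr q) * ennreal (\<bar>\<theta> / s\<bar> powr q * h (\<theta> / s)) \<partial>lborel)"
  proof (intro nn_integral_mono)
    fix \<theta>
    show "ennreal (h (\<theta> / s)) * indicator {\<theta>. t < \<bar>\<theta>\<bar>} \<theta>
      \<le> ennreal ((s / t) powr q) * ennreal (\<bar>\<theta> / s\<bar> powr q * h (\<theta> / s))"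
    proof (cases "t < \<bar>\<theta>\<bar>")
      case True
      have "1 \<le> (\<bar>\<theta>\<bar> / t) powr q"
        using True t q by (intro ge_one_powr_ge_zero) auto
      also have "\<bar>\<theta>\<bar> / t = s / t * \<bar>\<theta> / s\<bar>" using s by simp
      also have "\<dots> powr q = (s / t) powr q * \<bar>\<theta> / s\<bar> powr q"
        using s t by (intro powr_mult)
      finally have "h (\<theta> / s) \<le> (s / t) powr q * (\<bar>\<theta> / s\<bar> powr q * h (\<theta> / s))"
        using h_pos[of "\<theta> / s"] by simp
      then show ?thesis
        using True h_pos by (auto simp: ennreal_mult[symmetric] less_imp_le intro!: ennreal_leI)
    qed simp
  qed
  also have "\<dots> = ennreal ((s / t) powr q) * (ennreal s * (\<integral>\<^sup>+z. ennreal (\<bar>z\<bar> powr q * h z) \<partial>lborel))"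
    using nn_integral_rescale[of s "\<lambda>z. ennreal (\<bar>z\<bar> powr q * h z)"] s by (simp add: nn_integral_cmult)
  also have "(\<integral>\<^sup>+z. ennreal (\<bar>z\<bar> powr q * h z) \<partial>lborel) = ennreal (\<integral>z. \<bar>z\<bar> powr q * h z \<partial>lborel)"
    using h_pos by (intro nn_integral_eq_integral mom) (auto simp: less_imp_le)
  also have "ennreal ((s / t) powr q) * (ennreal s * ennreal (\<integral>z. \<bar>z\<bar> powr q * h z \<partial>lborel))
      = ennreal (s * (s / t) powr q * (\<integral>z. \<bar>z\<bar> powr q * h z \<partial>lborel))"
    using s h_pos by (simp add: ennreal_mult[symmetric] less_imp_le ac_simps)
  finally show ?thesis .
qed

text \<open>For data with \<open>\<bar>x\<bar> \<le> T / 2\<close> the likelihood ratio against \<open>0\<close> is at most \<open>1\<close> at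
  \<open>\<bar>\<theta>\<bar> > T\<close>; for \<open>\<bar>\<theta>\<bar> \<le> T\<close> its expectation is \<open>exp (n \<mu> \<theta>) \<le> e\<close> by the choice
  \<open>T = 1 / (n F)\<close>. Hence the posterior tail is essentially bounded by the prior tail.\<close>

lemma expected_posterior_coord_fine:
  fixes n :: nat and s \<mu> F t q :: real
  assumes n: "n > 0" and s: "s > 0" "n * s\<^sup>2 \<le> 1" and F: "\<bar>\<mu>\<bar> \<le> F" "F > 0" "4 * (n * F\<^sup>2) \<le> 1"
    and t: "2 * F \<le> t" and q: "q > 0"
    and mom: "integrable lborel (\<lambda>z. \<bar>z\<bar> powr q * h z)"
  shows "(\<integral>\<^sup>+x. emeasure (posterior_coord h s n x) {\<theta>. t < \<bar>\<theta> - \<mu>\<bar>}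
      \<partial>density lborel (normal_density \<mu> (1 / sqrt n)))
    \<le> ennreal (2 * exp (- (1 / (32 * (n * F\<^sup>2))))
        + exp (1 / 2) * (1 + exp 1) / h 1 * (\<integral>z. \<bar>z\<bar> powr q * h z \<partial>lborel) * (2 * s / t) powr q)"
proof -
  define T where "T = 1 / (n * F)"
  let ?A = "{\<theta>. t < \<bar>\<theta> - \<mu>\<bar>}" and ?A' = "{\<theta>. t / 2 < \<bar>\<theta>\<bar>}"
  let ?M = "density lborel (normal_density \<mu> (1 / sqrt n))"
  let ?G = "{x. T / 4 < \<bar>x - \<mu>\<bar>}"
  let ?m = "\<integral>z. \<bar>z\<bar> powr q * h z \<partial>lborel"
  let ?lr = "\<lambda>(x :: real) (\<theta> :: real). exp (n * x * \<theta> - n * \<theta>\<^sup>2 / 2)"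
  let ?p = "\<lambda>\<theta>. ennreal (h (\<theta> / s)) * indicator ?A' \<theta>"
  let ?u = "\<lambda>x \<theta>. (1 + ennreal (?lr x \<theta>) * indicator {-T..T} \<theta>) * ?p \<theta>"
  let ?K = "1 / (exp (- 1 / 2) * h 1 * s)"
  have T0: "T > 0" using n F by (simp add: T_def)
  have t0: "t > 0" using F t by simp
  \<comment> \<open>Makes |x| \<le> T/2 for all data outside \<open>?G\<close>, since there |x -
    \<mu>| \<le> T/4 and |\<mu>| \<le> F.\<close>
  have FT: "F \<le> T / 4" using n F by (simp add: T_def field_simps power2_eq_square)
  interpret M: prob_space ?M using n by (intro prob_space_normal_density) simp
  have G: "?G \<in> sets borel" and A: "?A \<in> sets borel" by measurable
  have le: "emeasure (posterior_coord h s n x) ?A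
      \<le> indicator ?G x + ennreal ?K * (\<integral>\<^sup>+\<theta>. ?u x \<theta> \<partial>lborel)" for x
  proof (cases "x \<in> ?G")
    case True
    interpret P: prob_space "posterior_coord h s n x" by (rule prob_space_posterior_coord[OF s(1)])
    show ?thesis using True P.emeasure_le_1[of ?A] by (simp add: add_increasing2)
  next
    case False
    then have x: "\<bar>x\<bar> \<le> T / 2" using FT F(1) abs_triangle_ineq[of "x - \<mu>" \<mu>] by simp
    let ?e = "exp (- (n * x\<^sup>2 / 2))"
    let ?d = "?e * (exp (- 1 / 2) * h 1 * s)"
    have d0: "?d > 0" using s h_pos[of 1] by simp
    have "(\<integral>\<^sup>+\<theta>. ennreal (posterior_weight h s n x \<theta>) * indicator ?A \<theta> \<partial>lborel)
        \<le> (\<integral>\<^sup>+\<theta>. ennreal ?e * ?u x \<theta> \<partial>lborel)"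
    proof (intro nn_integral_mono)
      fix \<theta>
      show "ennreal (posterior_weight h s n x \<theta>) * indicator ?A \<theta> \<le> ennreal ?e * ?u x \<theta>"
      proof (cases "\<theta> \<in> ?A")
        case True
        \<comment> \<open>From |\<mu>| \<le> F \<le> t/2: a deviation from \<mu> beyond
          \<open>t\<close> is a deviation from 0 beyond t/2, where the prior tail bound
          applies.\<close>
        then have A': "\<theta> \<in> ?A'" using t F(1) by auto
        have w: "posterior_weight h s n x \<theta> = ?e * (?lr x \<theta> * h (\<theta> / s))"
          by (simp add: posterior_weight_def exp_add[symmetric] power2_eq_square field_simps)
        have "ennreal (?lr x \<theta>) \<le> 1 + ennreal (?lr x \<theta>) * indicator {-T..T} \<theta>"
        proof (cases "\<bar>\<theta>\<bar> \<le> T")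
          case True
          then have "\<theta> \<in> {-T..T}" by auto
          then show ?thesis by (simp add: add_increasing)
        next
          case False
          have "2 * (x * \<theta>) \<le> 2 * \<bar>x\<bar> * \<bar>\<theta>\<bar>" by (simp add: abs_mult[symmetric])
          also have "\<dots> \<le> \<bar>\<theta>\<bar> * \<bar>\<theta>\<bar>" using x False by (intro mult_right_mono) auto
          finally have "2 * (x * \<theta>) \<le> \<theta>\<^sup>2" by (simp add: power2_eq_square)
          then have "n * (2 * (x * \<theta>)) \<le> n * \<theta>\<^sup>2" by (intro mult_left_mono) auto
          then have "?lr x \<theta> \<le> 1" by simp
          then show ?thesis by (simp add: add_increasing2)
        qed
        then have "ennreal ?e * (ennreal (?lr x \<theta>) * ennreal (h (\<theta> / s)))
            \<le> ennreal ?e * ((1 + ennreal (?lr x \<theta>) * indicator {-T..T} \<theta>) * ennreal (h (\<theta> / s)))"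
          by (intro mult_left_mono mult_right_mono) auto
        then show ?thesis
          using True A' h_pos[of "\<theta> / s"] by (simp add: w ennreal_mult less_imp_le)
      qed simp
    qed
    also have "\<dots> = ennreal ?e * (\<integral>\<^sup>+\<theta>. ?u x \<theta> \<partial>lborel)"
      by (intro nn_integral_cmult) measurable
    finally have N: "(\<integral>\<^sup>+\<theta>. ennreal (posterior_weight h s n x \<theta>) * indicator ?A \<theta> \<partial>lborel)
        \<le> ennreal ?e * (\<integral>\<^sup>+\<theta>. ?u x \<theta> \<partial>lborel)" .
    have "emeasure (posterior_coord h s n x) ?A
      \<le> ennreal (1 / ?d) * (\<integral>\<^sup>+\<theta>. ennreal (posterior_weight h s n x \<theta>) * indicator ?A \<theta> \<partial>lborel)"
      by (rule emeasure_posterior_coord_le[OF s(1) A d0 posterior_weight_integral_ge_central[OF s]])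
    also have "\<dots> \<le> ennreal (1 / ?d) * (ennreal ?e * (\<integral>\<^sup>+\<theta>. ?u x \<theta> \<partial>lborel))"
      using N by (intro mult_left_mono) auto
    also have "\<dots> = ennreal (1 / ?d * ?e) * (\<integral>\<^sup>+\<theta>. ?u x \<theta> \<partial>lborel)"
      using d0 by (subst mult.assoc[symmetric], subst ennreal_mult[symmetric])
        (auto intro!: less_imp_le[OF divide_pos_pos])
    \<comment> \<open>The data-dependent factors of numerator and denominator cancel here, leaving a
      constant independent of \<open>x\<close>.\<close>
    also have "1 / ?d * ?e = ?K" by simp
    finally show ?thesis using False by simp
  qed
  have u_meas: "(\<lambda>(x, \<theta>). ?u x \<theta>) \<in> borel_measurable (borel \<Otimes>\<^sub>M lborel)"
    by measurable
  have u_meas': "(\<lambda>(x, \<theta>). ?u x \<theta>) \<in> borel_measurable (?M \<Otimes>\<^sub>M lborel)"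
    using u_meas by (simp cong: measurable_cong_sets sets_pair_measure_cong)
  have u_int [measurable]: "(\<lambda>x. \<integral>\<^sup>+\<theta>. ?u x \<theta> \<partial>lborel) \<in> borel_measurable borel"
    using u_meas by (intro sigma_finite_measure.borel_measurable_nn_integral)
      (auto intro: sigma_finite_lborel)
  \<comment> \<open>Tonelli's theorem lets the data be integrated first: for fixed \<theta> the
    expected likelihood ratio is explicit, and what remains is a prior tail.\<close>
  interpret pair_sigma_finite ?M lborel
    by (intro pair_sigma_finite.intro M.sigma_finite_measure_axioms sigma_finite_lborel)
  have "(\<integral>\<^sup>+x. \<integral>\<^sup>+\<theta>. ?u x \<theta> \<partial>lborel \<partial>?M) = (\<integral>\<^sup>+\<theta>. \<integral>\<^sup>+x. ?u x \<theta> \<partial>?M \<partial>lborel)"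
    using Fubini'[OF u_meas'] by simp
  also have "\<dots> \<le> (\<integral>\<^sup>+\<theta>. ennreal (1 + exp 1) * ?p \<theta> \<partial>lborel)"
  proof (intro nn_integral_mono)
    fix \<theta>
    have "(\<integral>\<^sup>+x. ?u x \<theta> \<partial>?M) = (\<integral>\<^sup>+x. 1 + ennreal (?lr x \<theta>) * indicator {-T..T} \<theta> \<partial>?M) * ?p \<theta>"
      by (intro nn_integral_multc) measurable
    also have "(\<integral>\<^sup>+x. 1 + ennreal (?lr x \<theta>) * indicator {-T..T} \<theta> \<partial>?M)
        = 1 + ennreal (exp (n * \<mu> * \<theta>)) * indicator {-T..T} \<theta>"
      using M.emeasure_space_1 nn_integral_normal_tilt[OF n, where \<mu> = \<mu> and \<theta> = \<theta>]
      by (subst nn_integral_add) (auto simp: nn_integral_multc)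
    also have "\<dots> \<le> ennreal (1 + exp 1)"
    proof (cases "\<theta> \<in> {-T..T}")
      case True
      have "\<mu> * \<theta> \<le> \<bar>\<mu>\<bar> * \<bar>\<theta>\<bar>" by (simp add: abs_mult[symmetric])
      also have "\<dots> \<le> F * T" using True F by (intro mult_mono) auto
      finally have "n * (\<mu> * \<theta>) \<le> n * (F * T)" by (intro mult_left_mono) auto
      also have "\<dots> = 1" using n F by (simp add: T_def)
      finally have "exp (n * \<mu> * \<theta>) \<le> exp 1" by (simp add: mult.assoc)
      then show ?thesis using True by (simp add: ennreal_plus ennreal_leI)
    qed (simp add: ennreal_plus add_increasing2)
    finally show "(\<integral>\<^sup>+x. ?u x \<theta> \<partial>?M) \<le> ennreal (1 + exp 1) * ?p \<theta>"
      by (simp add: mult_right_mono)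
  qed
  also have "\<dots> = ennreal (1 + exp 1) * (\<integral>\<^sup>+\<theta>. ?p \<theta> \<partial>lborel)"
    by (intro nn_integral_cmult) measurable
  also have "\<dots> \<le> ennreal (1 + exp 1) * ennreal (s * (s / (t / 2)) powr q * ?m)"
    using t0 by (intro mult_left_mono prior_tail s q mom) auto
  finally have u_le: "(\<integral>\<^sup>+x. \<integral>\<^sup>+\<theta>. ?u x \<theta> \<partial>lborel \<partial>?M)
      \<le> ennreal (1 + exp 1) * ennreal (s * (s / (t / 2)) powr q * ?m)" .
  have m0: "?m \<ge> 0" using h_pos by (intro integral_nonneg_AE) (auto simp: less_imp_le)
  have K0: "?K \<ge> 0" using s h_pos[of 1] by simp
  have "(\<integral>\<^sup>+x. emeasure (posterior_coord h s n x) ?A \<partial>?M)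
      \<le> (\<integral>\<^sup>+x. indicator ?G x + ennreal ?K * (\<integral>\<^sup>+\<theta>. ?u x \<theta> \<partial>lborel) \<partial>?M)"
    using le by (intro nn_integral_mono)
  also have "\<dots> = emeasure ?M ?G + ennreal ?K * (\<integral>\<^sup>+x. \<integral>\<^sup>+\<theta>. ?u x \<theta> \<partial>lborel \<partial>?M)"
    using G by (subst nn_integral_add) (auto simp: nn_integral_cmult)
  also have "\<dots> \<le> ennreal (2 * exp (- (n * (T / 4)\<^sup>2 / 2)))
      + ennreal ?K * (ennreal (1 + exp 1) * ennreal (s * (s / (t / 2)) powr q * ?m))"
    using u_le T0 by (intro add_mono normal_tail n mult_left_mono) auto
  also have "\<dots> = ennreal (2 * exp (- (n * (T / 4)\<^sup>2 / 2))
      + ?K * ((1 + exp 1) * (s * (s / (t / 2)) powr q * ?m)))"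
    using s m0 K0 less_imp_le[OF h_pos[of 1]]
    by (subst ennreal_mult[symmetric], simp, simp, subst ennreal_mult[symmetric], simp, simp,
        subst ennreal_plus[symmetric])
      (auto intro!: divide_nonneg_nonneg mult_nonneg_nonneg add_nonneg_nonneg)
  also have "n * (T / 4)\<^sup>2 / 2 = 1 / (32 * (n * F\<^sup>2))"
    using n F by (simp add: T_def power2_eq_square field_simps)
  also have "?K * ((1 + exp 1) * (s * (s / (t / 2)) powr q * ?m))
      = exp (1 / 2) * (1 + exp 1) / h 1 * ?m * (2 * s / t) powr q"
    using s h_pos[of 1] by (simp add: exp_minus field_simps)
  finally show ?thesis .
qed

end

section \<open>Summation over the levels\<close>

text \<open>The real solution of 2^(J \<gamma>) = y is rounded up, which costs at most a factor 2 in
  2^J. The hypothesis \<open>y \<ge> 1\<close> keeps \<open>nat\<close> from truncating.\<close>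

lemma level_cutoff:
  fixes y \<gamma> :: real
  assumes "y \<ge> 1" "\<gamma> > 0"
  obtains J :: nat where "y \<le> 2 powr (real J * \<gamma>)" "2 ^ J \<le> 2 * y powr (1 / \<gamma>)"
proof
  let ?J = "nat \<lceil>log 2 y / \<gamma>\<rceil>"
  have "log 2 y / \<gamma> \<ge> 0" using assms by simp
  then have J: "log 2 y / \<gamma> \<le> real ?J" "real ?J \<le> log 2 y / \<gamma> + 1" by linarith+
  have "y = 2 powr (log 2 y)" using assms by simp
  also have "\<dots> \<le> 2 powr (real ?J * \<gamma>)"
    using J(1) assms(2) by (intro powr_mono) (auto simp: pos_divide_le_eq)
  finally show "y \<le> 2 powr (real ?J * \<gamma>)" .
  have "2 ^ ?J = 2 powr real ?J" by (simp add: powr_realpow)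
  also have "\<dots> \<le> 2 powr (log 2 y * (1 / \<gamma>) + 1)" using J(2) by simp
  also have "\<dots> = 2 * (2 powr log 2 y) powr (1 / \<gamma>)" by (simp only: powr_add powr_powr) simp
  also have "2 powr log 2 y = y" using assms by simp
  finally show "2 ^ ?J \<le> 2 * y powr (1 / \<gamma>)" .
qed

text \<open>From level \<open>J\<close> on, 2^(l/2) times the threshold is ln n times the geometric
  mean of 2^(-l \<beta>) and 2^(-J \<beta>). So the threshold is summable in sup norm, yet exceeds
  2^(-l (1/2 + \<beta>)) by the factor ln n * 2^((l-J) \<beta>/2).\<close>

definition threshold :: "real \<Rightarrow> real \<Rightarrow> nat \<Rightarrow> nat \<Rightarrow> nat \<Rightarrow> real" where
  "threshold \<beta> \<tau> n J l =
    (if l < J then ln n powr \<tau> / sqrt n else ln n * 2 powr (- ((l * (1 + \<beta>) + J * \<beta>) / 2)))"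

text \<open>Below \<open>J\<close> the sum is at most J times its bound at the cutoff; above, it is
  geometric with ratio 2^(-\<beta>/2). Both parts are n^(-\<beta>/(1+2\<beta>)) up to logarithms. In
  the exponent \<tau> + 3, two logarithms come from J and 2^(J/2), and the third absorbs the
  constants through \<open>big\<close>.\<close>

lemma threshold_sum:
  fixes n J :: nat and \<beta> \<tau> C :: real
  assumes \<beta>: "\<beta> > 0" and C: "C \<ge> 0" and \<tau>: "\<tau> \<ge> 0" and n: "n > 0" and \<Lambda>: "ln n \<ge> 1"
    and J: "n * (ln n)\<^sup>2 \<le> 2 powr (J * (1 + 2 * \<beta>))"
      "2 ^ J \<le> 2 * (n * (ln n)\<^sup>2) powr (1 / (1 + 2 * \<beta>))" "J \<le> 7 * ln n"
    and big: "C * (14 + 1 / (1 - 2 powr (- \<beta> / 2))) \<le> ln n"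
  defines "f \<equiv> \<lambda>l. C * 2 powr (real l / 2) * threshold \<beta> \<tau> n J l"
  shows "summable f" "suminf f \<le> ln n powr (\<tau> + 3) * (ln n / n) powr (\<beta> / (2 * \<beta> + 1))"
proof -
  define \<Lambda> \<gamma> \<rho> where "\<Lambda> = ln n" and "\<gamma> = 1 + 2 * \<beta>" and "\<rho> = 2 powr (- \<beta> / 2)"
  define N where "N = n powr (- \<beta> / \<gamma>)"
  have \<Lambda>1: "\<Lambda> \<ge> 1" and \<gamma>: "\<gamma> > 1" "\<gamma> = 1 + 2 * \<beta>" using \<Lambda> \<beta> by (auto simp: \<Lambda>_def \<gamma>_def)
  have \<rho>: "0 \<le> \<rho>" "\<rho> < 1" using \<beta> by (auto simp: \<rho>_def powr_less_one)
  have \<rho>_pow: "\<rho> ^ i = 2 powr (- \<beta> / 2 * i)" for i by (simp add: \<rho>_def powr_realpow[symmetric] powr_powr)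
  have n1: "real n \<ge> 1" using n by simp
  have N0: "N > 0" using n by (simp add: N_def)
  have shift: "f (i + J) = C * \<Lambda> * 2 powr (- (J * \<beta>)) * \<rho> ^ i" for i
  proof -
    have "f (i + J) = C * \<Lambda> * (2 powr (real (i + J) / 2) * 2 powr (- ((real (i + J) * (1 + \<beta>) + J * \<beta>) / 2)))"
      by (simp add: f_def threshold_def \<Lambda>_def)
    also have "2 powr (real (i + J) / 2) * 2 powr (- ((real (i + J) * (1 + \<beta>) + J * \<beta>) / 2))
        = 2 powr (- (J * \<beta>)) * 2 powr (- \<beta> / 2 * i)"
      unfolding powr_add[symmetric] by (rule arg_cong[where f = "(powr) 2"]) (simp add: field_simps)
    finally show ?thesis by (simp add: \<rho>_pow)
  qed
  have shift': "(\<lambda>i. f (i + J)) sums (C * \<Lambda> * 2 powr (- (J * \<beta>)) * (1 / (1 - \<rho>)))"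
    unfolding shift using \<rho> by (intro sums_mult geometric_sums) simp
  then show sf: "summable f" using sums_summable summable_iff_shift by blast
  have "suminf f = C * \<Lambda> * 2 powr (- (J * \<beta>)) * (1 / (1 - \<rho>)) + (\<Sum>l<J. f l)"
    using suminf_split_initial_segment[OF sf, of J] sums_unique[OF shift'] by simp
  also have "C * \<Lambda> * 2 powr (- (J * \<beta>)) * (1 / (1 - \<rho>)) \<le> C * (1 / (1 - \<rho>)) * (\<Lambda> powr (\<tau> + 2) * N)"
  proof -
    have "2 powr (- (J * \<beta>)) = (2 powr (J * \<gamma>)) powr (- \<beta> / \<gamma>)" using \<gamma> by (simp add: powr_powr)
    also have "\<dots> \<le> n powr (- \<beta> / \<gamma>)"
    proof (rule powr_mono2')
      have "real n * 1 \<le> n * (ln n)\<^sup>2" using \<Lambda> by (intro mult_left_mono) auto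
      then show "real n \<le> 2 powr (J * \<gamma>)" using J(1) by (simp add: \<gamma>_def)
    qed (use \<beta> \<gamma> n in auto)
    finally have "2 powr (- (J * \<beta>)) \<le> N" by (simp add: N_def)
    moreover have "\<Lambda> \<le> \<Lambda> powr (\<tau> + 2)" using \<Lambda>1 \<tau> powr_mono[of 1 "\<tau> + 2" \<Lambda>] by simp
    ultimately have "\<Lambda> * 2 powr (- (J * \<beta>)) \<le> \<Lambda> powr (\<tau> + 2) * N"
      using \<Lambda>1 by (intro mult_mono) auto
    then have "C * (1 / (1 - \<rho>)) * (\<Lambda> * 2 powr (- (J * \<beta>))) \<le> C * (1 / (1 - \<rho>)) * (\<Lambda> powr (\<tau> + 2) * N)"
      using C \<rho> by (intro mult_left_mono) auto
    then show ?thesis by (simp add: ac_simps)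
  qed
  \<comment> \<open>The constant is 7 from the bound on J times 2 from the bound on 2^(J/2).\<close>
  also have "(\<Sum>l<J. f l) \<le> C * 14 * (\<Lambda> powr (\<tau> + 2) * N)"
  proof -
    have "f l \<le> C * 2 powr (real J / 2) * (\<Lambda> powr \<tau> / sqrt n)" if "l < J" for l
      using that C by (auto simp: f_def threshold_def \<Lambda>_def intro!: divide_right_mono mult_right_mono mult_left_mono)
    then have "(\<Sum>l<J. f l) \<le> real J * (C * 2 powr (real J / 2) * (\<Lambda> powr \<tau> / sqrt n))"
      by (intro order_trans[OF sum_bounded_above]) auto
    also have "\<dots> \<le> (7 * \<Lambda>) * (C * (2 * (\<Lambda> * n powr (1 / (2 * \<gamma>)))) * (\<Lambda> powr \<tau> / sqrt n))"
    proof (intro mult_mono)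
      have "2 powr (real J / 2) = sqrt (2 ^ J)"
        by (simp add: powr_half_sqrt[symmetric] powr_realpow[symmetric] powr_powr)
      also have "\<dots> \<le> sqrt (2 * (n * \<Lambda>\<^sup>2) powr (1 / \<gamma>))" using J(2) by (simp add: \<Lambda>_def \<gamma>_def)
      also have "\<dots> \<le> 2 * sqrt ((n * \<Lambda>\<^sup>2) powr (1 / \<gamma>))"
        by (auto simp: real_sqrt_mult sqrt2_less_2[THEN less_imp_le] intro!: mult_right_mono)
      also have "sqrt ((n * \<Lambda>\<^sup>2) powr (1 / \<gamma>)) = n powr (1 / (2 * \<gamma>)) * \<Lambda> powr (1 / \<gamma>)"
      proof -
        have "\<Lambda>\<^sup>2 = \<Lambda> powr 2" using \<Lambda>1 by simp
        then have "sqrt ((n * \<Lambda>\<^sup>2) powr (1 / \<gamma>)) = (n * \<Lambda> powr 2) powr (1 / \<gamma> / 2)"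
          by (subst powr_half_sqrt_powr) auto
        then show ?thesis using \<Lambda>1 by (simp only: powr_mult powr_powr) (simp add: mult.commute)
      qed
      also have "\<dots> \<le> n powr (1 / (2 * \<gamma>)) * \<Lambda>"
        using \<Lambda>1 \<gamma> powr_mono[of "1 / \<gamma>" 1 \<Lambda>] by (intro mult_left_mono) auto
      finally show "2 powr (real J / 2) \<le> 2 * (\<Lambda> * n powr (1 / (2 * \<gamma>)))" by (simp add: mult.commute)
    qed (use C J(3) \<Lambda>1 in \<open>auto simp: \<Lambda>_def\<close>)
    also have "\<dots> = C * 14 * (\<Lambda> * \<Lambda> * \<Lambda> powr \<tau> * (n powr (1 / (2 * \<gamma>)) / sqrt n))"
      by (simp add: field_simps)
    also have "\<Lambda> * \<Lambda> * \<Lambda> powr \<tau> = \<Lambda> powr (\<tau> + 2)"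
      using \<Lambda>1 by (simp add: powr_add power2_eq_square)
    also have "n powr (1 / (2 * \<gamma>)) / sqrt n = N"
    proof -
      have "n powr (1 / (2 * \<gamma>)) / sqrt n = n powr (1 / (2 * \<gamma>) - 1 / 2)"
        using n by (simp add: powr_diff powr_half_sqrt)
      also have "1 / (2 * \<gamma>) - 1 / 2 = - \<beta> / \<gamma>" using \<gamma> by (simp add: field_simps)
      finally show ?thesis by (simp add: N_def)
    qed
    finally show ?thesis .
  qed
  also have "C * (1 / (1 - \<rho>)) * (\<Lambda> powr (\<tau> + 2) * N) + C * 14 * (\<Lambda> powr (\<tau> + 2) * N)
      = C * (14 + 1 / (1 - \<rho>)) * (\<Lambda> powr (\<tau> + 2) * N)"
    by (simp add: algebra_simps)
  also have "\<dots> \<le> \<Lambda> * (\<Lambda> powr (\<tau> + 2) * N)"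
    using big N0 by (intro mult_right_mono) (auto simp: \<rho>_def \<Lambda>_def)
  also have "\<dots> = \<Lambda> powr (\<tau> + 3) * N * 1"
    using \<Lambda>1 powr_add[of \<Lambda> 1 "\<tau> + 2"] by (simp add: algebra_simps)
  \<comment> \<open>Inserts a factor at least 1 to turn the power of 1/n into a power of ln n /
    n.\<close>
  also have "\<dots> \<le> \<Lambda> powr (\<tau> + 3) * N * \<Lambda> powr (\<beta> / \<gamma>)"
    using \<Lambda>1 \<beta> \<gamma> N0 by (intro mult_left_mono ge_one_powr_ge_zero) auto
  also have "\<dots> = \<Lambda> powr (\<tau> + 3) * (\<Lambda> / n) powr (\<beta> / \<gamma>)"
    using \<Lambda>1 by (simp add: N_def powr_divide powr_minus_divide)
  finally show "suminf f \<le> ln n powr (\<tau> + 3) * (ln n / n) powr (\<beta> / (2 * \<beta> + 1))"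
    by (simp add: \<Lambda>_def \<gamma>_def add.commute)
qed

section \<open>Coordinate bounds on either side of the cutoff, and their sum\<close>

context even_density
begin

text \<open>The price of the heavy tail: with l = O(ln n), ln (1/s) is at most of order (ln n)^2, so
  the tail condition makes 1/h only the exponential of a power of ln n. The quadratic exponent in
  the lower bound on \<open>s\<close> accommodates both kinds of prior scale.\<close>

lemma inverse_h_le:
  assumes tail: "\<And>x. x \<ge> 0 \<Longrightarrow> ln (1 / h x) \<le> c1 * (1 + ln (1 + x) powr (1 + \<kappa>))"
    and s: "0 < s" "s \<le> 1" "2 powr (- A * (real l + 1)\<^sup>2) \<le> s"
    and "A \<ge> 0" "L \<ge> 0" "c1 \<ge> 0" "\<kappa> \<ge> 0" "\<Lambda> \<ge> 1" "real l + 1 \<le> 7 * \<Lambda>"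
  shows "1 / h ((L + 1) / s) \<le> exp (c1 * (1 + ((ln (L + 2) + 49 * A * ln 2) * \<Lambda>\<^sup>2) powr (1 + \<kappa>)))"
proof -
  have "ln (1 + (L + 1) / s) \<le> ln ((L + 2) / s)"
    using assms by (intro ln_mono) (auto simp: field_simps)
  also have "\<dots> = ln (L + 2) - ln s" using assms by (simp add: ln_div)
  also have "\<dots> \<le> ln (L + 2) + A * (real l + 1)\<^sup>2 * ln 2"
    using ln_mono[OF s(3)] by (simp add: ln_powr)
  also have "\<dots> \<le> ln (L + 2) * \<Lambda>\<^sup>2 + A * (7 * \<Lambda>)\<^sup>2 * ln 2"
    using assms by (intro add_mono mult_right_mono mult_left_mono power_mono) (auto simp: mult_le_cancel_left1)
  also have "\<dots> = (ln (L + 2) + 49 * A * ln 2) * \<Lambda>\<^sup>2"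
    by (simp add: power_mult_distrib algebra_simps)
  finally have "ln (1 + (L + 1) / s) powr (1 + \<kappa>) \<le> \<dots> powr (1 + \<kappa>)"
    using assms by (intro powr_mono2) auto
  then have "c1 * (1 + ln (1 + (L + 1) / s) powr (1 + \<kappa>))
      \<le> c1 * (1 + ((ln (L + 2) + 49 * A * ln 2) * \<Lambda>\<^sup>2) powr (1 + \<kappa>))"
    using assms by (intro mult_left_mono) auto
  moreover have "(L + 1) / s \<ge> 0" using assms by simp
  ultimately have "ln (1 / h ((L + 1) / s)) \<le> c1 * (1 + ((ln (L + 2) + 49 * A * ln 2) * \<Lambda>\<^sup>2) powr (1 + \<kappa>))"
    using tail order_trans by blast
  then have "exp (ln (1 / h ((L + 1) / s))) \<le> exp (c1 * (1 + ((ln (L + 2) + 49 * A * ln 2) * \<Lambda>\<^sup>2) powr (1 + \<kappa>)))"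
    by simp
  then show ?thesis using h_pos by simp
qed

text \<open>The choice T = (ln n)^(2+\<kappa>) makes T^2 larger by a factor (ln n)^2 than the prior
  cost (ln n)^(2+2\<kappa>) in the exponent. Since T^2 \<ge> (ln n)^4, the result decays faster than
  any power of n.\<close>

lemma expected_posterior_coord_below_cutoff:
  fixes n :: nat and s :: real and A \<mu> c1 \<kappa> \<beta> L :: real
  assumes tail: "\<And>x. x \<ge> 0 \<Longrightarrow> ln (1 / h x) \<le> c1 * (1 + ln (1 + x) powr (1 + \<kappa>))"
    and s: "0 < s" "s \<le> 1" "2 powr (- A * (real l + 1)\<^sup>2) \<le> s"
    and A: "A \<ge> 0" and L: "L \<ge> 0" "\<bar>\<mu>\<bar> \<le> L" and c1: "c1 \<ge> 0" and \<kappa>: "\<kappa> \<ge> 0"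
    and n: "n > 0" and l: "l < J" "J \<le> 7 * ln n"
    and big: "8 \<le> ln n" "32 * (1 + c1 + c1 * (ln (L + 2) + 49 * A * ln 2) powr (1 + \<kappa>)) \<le> ln n"
  shows "(\<integral>\<^sup>+x. emeasure (posterior_coord h s n x) {\<theta>. threshold \<beta> (2 + \<kappa>) n J l < \<bar>\<theta> - \<mu>\<bar>}
      \<partial>density lborel (normal_density \<mu> (1 / sqrt n)))
    \<le> ennreal (3 * exp (- (ln n ^ 4 / 32)))"
proof -
  define \<Lambda> B T W where "\<Lambda> = ln n" and "B = ln (L + 2) + 49 * A * ln 2"
    and "T = \<Lambda> powr (2 + \<kappa>)" and "W = \<Lambda> powr (2 + 2 * \<kappa>)"
  have \<Lambda>: "\<Lambda> \<ge> 8" using big by (simp add: \<Lambda>_def)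
  have B: "B \<ge> 0" using A L by (simp add: B_def)
  have "\<Lambda> ^ 2 \<le> T" using \<Lambda> \<kappa> powr_mono[of 2 "2 + \<kappa>" \<Lambda>] by (simp add: T_def)
  then have T: "\<Lambda> ^ 4 \<le> T\<^sup>2" using power_mono[of "\<Lambda>\<^sup>2" T 2] by simp
  have "\<Lambda> * 1 \<le> \<Lambda> * \<Lambda>" using \<Lambda> by (intro mult_left_mono) auto
  then have \<Lambda>_sq: "\<Lambda> \<le> \<Lambda>\<^sup>2" by (simp add: power2_eq_square)
  with \<open>\<Lambda> ^ 2 \<le> T\<close> \<Lambda> have "T \<ge> 8" by linarith
  then have "8 * T \<le> T * T" by (intro mult_right_mono) auto
  then have T8: "T / 4 \<le> T\<^sup>2 / 32" by (simp add: power2_eq_square)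
  \<comment> \<open>\<open>W\<close> is the order of the prior cost; the identity \<open>WT\<close>
    below expresses the gain.\<close>
  have W: "\<Lambda> \<le> W" using \<Lambda> \<kappa> powr_mono[of 1 "2 + 2 * \<kappa>" \<Lambda>] by (simp add: W_def)
  have \<Lambda>_powr: "\<Lambda>\<^sup>2 = \<Lambda> powr 2" using \<Lambda> by simp
  have WT: "W * \<Lambda>\<^sup>2 = T\<^sup>2"
  proof -
    have "W * \<Lambda>\<^sup>2 = \<Lambda> powr (2 + 2 * \<kappa> + 2)" unfolding W_def \<Lambda>_powr powr_add[of _ _ 2] ..
    also have "\<dots> = T\<^sup>2" unfolding T_def using \<Lambda> by (subst powr_power) (auto simp: algebra_simps)
    finally show ?thesis .
  qed
  have "1 / 2 + \<Lambda> / 2 + c1 * (1 + (B * \<Lambda>\<^sup>2) powr (1 + \<kappa>)) \<le> T\<^sup>2 / 32"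
  proof -
    have "(B * \<Lambda>\<^sup>2) powr (1 + \<kappa>) = B powr (1 + \<kappa>) * W"
      unfolding \<Lambda>_powr using B \<Lambda> by (simp only: powr_mult W_def powr_powr distrib_left mult_1_right)
    then have "1 / 2 + \<Lambda> / 2 + c1 * (1 + (B * \<Lambda>\<^sup>2) powr (1 + \<kappa>))
        = 1 / 2 + \<Lambda> / 2 + c1 * 1 + c1 * B powr (1 + \<kappa>) * W"
      by (simp add: algebra_simps)
    also have "\<dots> \<le> W / 2 + W / 2 + c1 * W + c1 * B powr (1 + \<kappa>) * W"
      using W \<Lambda> c1 by (intro add_mono mult_left_mono) auto
    also have "\<dots> = (1 + c1 + c1 * B powr (1 + \<kappa>)) * W" by (simp add: algebra_simps)
    also have "\<dots> \<le> (\<Lambda>\<^sup>2 / 32) * W"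
      using big(2) \<Lambda>_sq W \<Lambda> by (intro mult_right_mono) (auto simp: B_def \<Lambda>_def)
    finally show ?thesis using WT by (simp add: mult.commute)
  qed
  \<comment> \<open>T/4 and the remaining costs each take at most T^2/32 from the available
    T^2/4.\<close>
  then have expo: "1 / 2 + T / 4 - T\<^sup>2 / 4 + \<Lambda> / 2 + c1 * (1 + (B * \<Lambda>\<^sup>2) powr (1 + \<kappa>)) \<le> - (T\<^sup>2 / 32)"
    using T8 zero_le_power2[of T] by linarith
  have inv: "1 / h ((L + 1) / s) \<le> exp (c1 * (1 + (B * \<Lambda>\<^sup>2) powr (1 + \<kappa>)))"
    unfolding B_def using \<Lambda> l by (intro inverse_h_le[where l = l] tail s A L c1 \<kappa>) (auto simp: \<Lambda>_def)
  have sqrt_n: "sqrt n = exp (\<Lambda> / 2)"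
    using n by (simp add: \<Lambda>_def powr_half_sqrt[symmetric] powr_def)
  have "(\<integral>\<^sup>+x. emeasure (posterior_coord h s n x) {\<theta>. threshold \<beta> (2 + \<kappa>) n J l < \<bar>\<theta> - \<mu>\<bar>}
      \<partial>density lborel (normal_density \<mu> (1 / sqrt n)))
    \<le> ennreal (2 * exp (- (T\<^sup>2 / 32))
        + exp (1 / 2 + T / 4 - T\<^sup>2 / 4) * (s * sqrt n) / (2 * h ((L + 1) / s)))"
    using expected_posterior_coord_coarse[OF n s(1) L(2), of T] l(1)
    by (simp add: threshold_def T_def \<Lambda>_def)
  also have "\<dots> \<le> ennreal (3 * exp (- (\<Lambda> ^ 4 / 32)))"
  proof (rule ennreal_leI)
    have "exp (1 / 2 + T / 4 - T\<^sup>2 / 4) * (s * sqrt n) / (2 * h ((L + 1) / s))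
        = exp (1 / 2 + T / 4 - T\<^sup>2 / 4) * (s / 2 * exp (\<Lambda> / 2) * (1 / h ((L + 1) / s)))"
      by (simp add: sqrt_n)
    also have "\<dots> \<le> exp (1 / 2 + T / 4 - T\<^sup>2 / 4)
        * (1 * exp (\<Lambda> / 2) * exp (c1 * (1 + (B * \<Lambda>\<^sup>2) powr (1 + \<kappa>))))"
      using s inv h_pos by (intro mult_left_mono mult_mono) (auto simp: less_imp_le)
    also have "\<dots> = exp (1 / 2 + T / 4 - T\<^sup>2 / 4 + \<Lambda> / 2 + c1 * (1 + (B * \<Lambda>\<^sup>2) powr (1 + \<kappa>)))"
      by (simp add: exp_add)
    also have "\<dots> \<le> exp (- (T\<^sup>2 / 32))" using expo by simp
    finally have "2 * exp (- (T\<^sup>2 / 32)) + exp (1 / 2 + T / 4 - T\<^sup>2 / 4) * (s * sqrt n) / (2 * h ((L + 1) / s))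
        \<le> 3 * exp (- (T\<^sup>2 / 32))" by simp
    also have "\<dots> \<le> 3 * exp (- (\<Lambda> ^ 4 / 32))" using T by simp
    finally show "2 * exp (- (T\<^sup>2 / 32)) + exp (1 / 2 + T / 4 - T\<^sup>2 / 4) * (s * sqrt n) / (2 * h ((L + 1) / s))
        \<le> 3 * exp (- (\<Lambda> ^ 4 / 32))" .
  qed
  finally show ?thesis by (simp add: \<Lambda>_def)
qed

text \<open>The division by 2^l anticipates the sum over 2^l coordinates, after which both terms are
  geometric in l - J. The first is the prior tail, where 1/q in the scale exponent produces 2^(-l)
  and the slack of the threshold produces the ratio 2^(-\<beta>/2); the second is the Gaussian tail
  of the data.\<close>

lemma expected_posterior_coord_above_cutoff:
  fixes n l J :: nat and s \<mu> \<beta> q L :: real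
  assumes mom: "integrable lborel (\<lambda>z. \<bar>z\<bar> powr q * h z)" and q: "q \<ge> 1" and \<beta>: "\<beta> > 0" and L: "L > 0"
    and n: "n > 0" and l: "J \<le> l"
    and s: "0 < s" "s \<le> 2 powr (- (real l * (1 / 2 + \<beta> + 1 / q)))"
    and \<mu>: "\<bar>\<mu>\<bar> \<le> L * 2 powr (- (real l * (1 / 2 + \<beta>)))"
    and J: "n * (ln n)\<^sup>2 \<le> 2 powr (J * (1 + 2 * \<beta>))" "2 ^ J \<le> 2 * (n * (ln n)\<^sup>2)"
    and big: "1 \<le> ln n" "2 * L \<le> ln n" "exp (- ((ln n)\<^sup>2 / (32 * L\<^sup>2))) \<le> 1 / 4"
  shows "(\<integral>\<^sup>+x. emeasure (posterior_coord h s n x) {\<theta>. threshold \<beta> \<tau> n J l < \<bar>\<theta> - \<mu>\<bar>}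
      \<partial>density lborel (normal_density \<mu> (1 / sqrt n)))
    \<le> ennreal ((exp (1 / 2) * (1 + exp 1) / h 1 * (\<integral>z. \<bar>z\<bar> powr q * h z \<partial>lborel) * 2 powr q / ln n
          * (2 powr (- \<beta> / 2)) ^ (l - J)
        + 4 * (n * (ln n)\<^sup>2) * exp (- ((ln n)\<^sup>2 / (32 * L\<^sup>2))) * (1 / 2) ^ (l - J)) / 2 ^ l)"
proof -
  define \<Lambda> i F t c where "\<Lambda> = ln n" and "i = l - J" and "F = L * 2 powr (- (real l * (1 / 2 + \<beta>)))"
    and "t = threshold \<beta> \<tau> n J l" and "c = (ln n)\<^sup>2 / (32 * L\<^sup>2)"
  define M where "M = exp (1 / 2) * (1 + exp 1) / h 1 * (\<integral>z. \<bar>z\<bar> powr q * h z \<partial>lborel)"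
  have \<Lambda>: "\<Lambda> \<ge> 1" "\<Lambda> \<ge> 2 * L" using big by (auto simp: \<Lambda>_def)
  have li: "real l = real J + real i" using l by (simp add: i_def)
  have t_eq: "t = \<Lambda> * 2 powr (- ((l * (1 + \<beta>) + J * \<beta>) / 2))"
    using l by (simp add: t_def threshold_def \<Lambda>_def)
  have M0: "M \<ge> 0" unfolding M_def using h_pos
    by (intro mult_nonneg_nonneg divide_nonneg_nonneg integral_nonneg_AE add_nonneg_nonneg)
       (auto simp: less_imp_le)
  have F0: "F > 0" using L by (simp add: F_def)
  \<comment> \<open>With l = J + i, the cutoff inequality leaves the exponent - (1 + 2\<beta>) i, of
    which 2^(-i) is kept as decay in i.\<close>
  have decay: "n * 2 powr (- (real l * (1 + 2 * \<beta>))) * (\<Lambda>\<^sup>2 * 2 ^ i) \<le> 1"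
  proof -
    have "n * 2 powr (- (real l * (1 + 2 * \<beta>))) * (\<Lambda>\<^sup>2 * 2 ^ i)
        = (n * \<Lambda>\<^sup>2) * (2 powr (- (real l * (1 + 2 * \<beta>))) * 2 powr real i)"
      by (simp add: powr_realpow)
    also have "\<dots> \<le> 2 powr (J * (1 + 2 * \<beta>)) * (2 powr (- (real l * (1 + 2 * \<beta>))) * 2 powr real i)"
      using J(1) by (intro mult_right_mono) (auto simp: \<Lambda>_def)
    also have "\<dots> = 2 powr (- (2 * \<beta> * i))"
      unfolding powr_add[symmetric] by (rule arg_cong[where f = "(powr) 2"]) (simp add: li algebra_simps)
    also have "\<dots> \<le> 1" using \<beta> powr_mono[of "- (2 * \<beta> * i)" 0 2] by simp
    finally show ?thesis .
  qed
  have i1: "1 \<le> \<Lambda>\<^sup>2 * 2 ^ i" using \<Lambda> mult_mono[of 1 "\<Lambda>\<^sup>2" 1 "2 ^ i"] by simp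
  have decay1: "n * 2 powr (- (real l * (1 + 2 * \<beta>))) \<le> 1"
  proof -
    have "n * 2 powr (- (real l * (1 + 2 * \<beta>))) * 1 \<le> n * 2 powr (- (real l * (1 + 2 * \<beta>))) * (\<Lambda>\<^sup>2 * 2 ^ i)"
      using i1 by (intro mult_left_mono) auto
    then show ?thesis using decay by simp
  qed
  have ns: "n * s\<^sup>2 \<le> 1"
  proof -
    have "s\<^sup>2 \<le> (2 powr (- (real l * (1 / 2 + \<beta> + 1 / q))))\<^sup>2" using s by (intro power_mono) auto
    also have "\<dots> = 2 powr (- (real l * (1 + 2 * \<beta> + 2 / q)))"
      by (subst powr_power, simp, rule arg_cong[where f = "(powr) 2"]) (simp add: algebra_simps)
    also have "\<dots> \<le> 2 powr (- (real l * (1 + 2 * \<beta>)))"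
      using q by (intro powr_mono) (auto intro!: mult_left_mono)
    finally have "n * s\<^sup>2 \<le> n * 2 powr (- (real l * (1 + 2 * \<beta>)))" by (intro mult_left_mono) auto
    then show ?thesis using decay1 by simp
  qed
  have F2: "F\<^sup>2 = L\<^sup>2 * 2 powr (- (real l * (1 + 2 * \<beta>)))"
    unfolding F_def power_mult_distrib
    by (subst powr_power, simp, intro arg_cong2[where f = "(*)"] arg_cong[where f = "(powr) 2"])
       (simp_all add: algebra_simps)
  have nF: "n * F\<^sup>2 * (\<Lambda>\<^sup>2 * 2 ^ i) \<le> L\<^sup>2"
    using mult_left_mono[OF decay, of "L\<^sup>2"] by (simp add: F2 ac_simps)
  have nF4: "4 * (n * F\<^sup>2) \<le> 1"
  proof -
    have "4 * (n * F\<^sup>2) * \<Lambda>\<^sup>2 \<le> 4 * (n * F\<^sup>2 * (\<Lambda>\<^sup>2 * 2 ^ i))"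
      by (simp add: mult_left_mono mult_le_cancel_left1 mult.assoc)
    also have "\<dots> \<le> (2 * L)\<^sup>2" using nF by (simp add: power_mult_distrib)
    also have "\<dots> \<le> 1 * \<Lambda>\<^sup>2" using \<Lambda> L power_mono[of "2 * L" \<Lambda> 2] by simp
    finally show ?thesis using \<Lambda> mult_le_cancel_right_pos[of "\<Lambda>\<^sup>2"] by simp
  qed
  \<comment> \<open>For l \<ge> J the threshold is at least ln n times 2^(-l (1/2 + \<beta>)), and
    ln n \<ge> 2 L.\<close>
  have t2F: "2 * F \<le> t"
  proof -
    have "J * \<beta> \<le> l * \<beta>" using l \<beta> by (intro mult_right_mono) auto
    then have "2 powr (- (real l * (1 / 2 + \<beta>))) \<le> 2 powr (- ((l * (1 + \<beta>) + J * \<beta>) / 2))"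
      by (intro powr_mono) (auto simp: field_simps)
    then show ?thesis unfolding F_def t_eq mult.assoc[symmetric]
      using \<Lambda> L by (intro mult_mono) auto
  qed
  have t0: "t > 0" using F0 t2F by linarith
  have "(2 * s / t) powr q \<le> 2 powr q / \<Lambda> * (2 powr (- \<beta> / 2)) ^ i / 2 ^ l"
  proof -
    have "2 * s / t \<le> 2 * 2 powr (- (real l * (1 / 2 + \<beta> + 1 / q))) / t"
      using s t0 by (intro divide_right_mono) auto
    also have "\<dots> = 2 / \<Lambda> * (2 powr (- (real l * (1 / 2 + \<beta> + 1 / q))) / 2 powr (- ((l * (1 + \<beta>) + J * \<beta>) / 2)))"
      by (simp add: t_eq)
    also have "2 powr (- (real l * (1 / 2 + \<beta> + 1 / q))) / 2 powr (- ((l * (1 + \<beta>) + J * \<beta>) / 2))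
        = 2 powr (- (\<beta> / 2 * i) - l / q)"
      unfolding powr_diff[symmetric]
      by (rule arg_cong[where f = "(powr) 2"]) (simp add: li field_simps)
    finally have "(2 * s / t) powr q \<le> (2 / \<Lambda> * 2 powr (- (\<beta> / 2 * i) - l / q)) powr q"
      using s t0 q by (intro powr_mono2) auto
    also have "\<dots> = (2 / \<Lambda>) powr q * 2 powr ((- (\<beta> / 2 * i) - l / q) * q)"
      using \<Lambda> by (subst powr_mult) (auto simp: powr_powr)
    also have "(- (\<beta> / 2 * i) - l / q) * q = - (\<beta> / 2 * i * q) - l"
      using q by (simp add: field_simps)
    also have "(2 / \<Lambda>) powr q * 2 powr (- (\<beta> / 2 * i * q) - l) \<le> (2 powr q / \<Lambda>) * 2 powr (- (\<beta> / 2 * i) - l)"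
    proof (intro mult_mono powr_mono)
      show "(2 / \<Lambda>) powr q \<le> 2 powr q / \<Lambda>"
        using \<Lambda> q powr_mono[of 1 q \<Lambda>] by (simp add: powr_divide divide_left_mono)
      show "- (\<beta> / 2 * i * q) - real l \<le> - (\<beta> / 2 * i) - real l"
        using \<beta> q mult_left_mono[of 1 q "\<beta> / 2 * i"] by simp
    qed (use \<Lambda> in auto)
    also have "2 powr (- (\<beta> / 2 * i) - l) = (2 powr (- \<beta> / 2)) ^ i / 2 ^ l"
      by (simp add: powr_diff powr_realpow[symmetric] powr_powr)
    finally show ?thesis by simp
  qed
  then have part1: "M * (2 * s / t) powr q \<le> M * 2 powr q / \<Lambda> * (2 powr (- \<beta> / 2)) ^ i / 2 ^ l"
    using mult_left_mono[of _ _ M] M0 by (fastforce simp: mult.assoc)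
  have part2: "2 * exp (- (1 / (32 * (n * F\<^sup>2)))) \<le> 4 * (n * \<Lambda>\<^sup>2) * exp (- c) * (1 / 2) ^ i / 2 ^ l"
  proof -
    \<comment> \<open>Weakens exp (- c 2^i) to exp (- c) exp (- c)^i. As exp (- c) \<le> 1/4, this
      absorbs the factor 2^i in 2^l = 2^J 2^i and leaves (1/2)^i.\<close>
    have "Suc i \<le> 2 ^ i" by (simp add: Suc_leI)
    then have "real (Suc i) \<le> real (2 ^ i)" by (rule of_nat_mono)
    then have "real (Suc i) \<le> 2 ^ i" by (simp only: of_nat_power of_nat_numeral)
    then have "real (Suc i) * c \<le> 2 ^ i * c" by (intro mult_right_mono) (auto simp: c_def)
    also have "\<dots> \<le> 1 / (32 * (n * F\<^sup>2))"
      using nF n F0 L by (simp add: c_def \<Lambda>_def field_simps)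
    finally have "exp (- (1 / (32 * (n * F\<^sup>2)))) \<le> exp (- (real (Suc i) * c))" by simp
    also have "\<dots> = exp (- c) * exp (- c) ^ i"
      by (simp add: exp_of_nat_mult[symmetric] exp_add[symmetric] algebra_simps)
    also have "\<dots> \<le> exp (- c) * (1 / 4) ^ i"
      using big(3) by (intro mult_left_mono power_mono) (auto simp: c_def)
    finally have "2 * exp (- (1 / (32 * (n * F\<^sup>2)))) \<le> 2 * (exp (- c) * (1 / 4) ^ i)" by simp
    also have "\<dots> = 2 * (exp (- c) * (1 / 4) ^ i) * (2 ^ J * 2 ^ i) / 2 ^ l"
      using l by (simp add: power_add[symmetric] i_def)
    also have "\<dots> \<le> 2 * (exp (- c) * (1 / 4) ^ i) * ((2 * (n * \<Lambda>\<^sup>2)) * 2 ^ i) / 2 ^ l"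
      using J(2) by (intro divide_right_mono mult_left_mono mult_right_mono) (auto simp: \<Lambda>_def)
    also have "\<dots> = 4 * (n * \<Lambda>\<^sup>2) * exp (- c) * ((1 / 4) ^ i * 2 ^ i) / 2 ^ l" by simp
    also have "(1 / 4) ^ i * 2 ^ i = (1 / 2 :: real) ^ i" by (simp add: power_mult_distrib[symmetric])
    finally show ?thesis .
  qed
  have q0: "q > 0" using q by simp
  have "(\<integral>\<^sup>+x. emeasure (posterior_coord h s n x) {\<theta>. t < \<bar>\<theta> - \<mu>\<bar>}
      \<partial>density lborel (normal_density \<mu> (1 / sqrt n)))
    \<le> ennreal (2 * exp (- (1 / (32 * (n * F\<^sup>2)))) + M * (2 * s / t) powr q)"
    unfolding M_def
    by (rule expected_posterior_coord_fine[OF n s(1) ns \<mu>[folded F_def] F0 nF4 t2F q0 mom])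
  also have "\<dots> \<le> ennreal ((M * 2 powr q / \<Lambda> * (2 powr (- \<beta> / 2)) ^ i
      + 4 * (n * \<Lambda>\<^sup>2) * exp (- c) * (1 / 2) ^ i) / 2 ^ l)"
    using part1 part2 unfolding add_divide_distrib by (intro ennreal_leI) linarith
  finally show ?thesis by (simp only: M_def \<Lambda>_def i_def c_def t_def)
qed

text \<open>Non-asymptotic form, with all largeness conditions on n collected in \<open>big\<close>.
  The level \<open>l0\<close> allows the upper bound on the scales to start late. The exponent 5 +
  \<kappa> is \<tau> + 3 with \<tau> = 2 + \<kappa>.\<close>

lemma expected_posterior_sup_bound:
  fixes n l0 :: nat and s :: "nat \<Rightarrow> real" and \<beta> L C A c1 \<kappa> q :: real
  assumes loc: "\<And>l x. x \<in> {0..1} \<Longrightarrow> (\<Sum>k<2 ^ l. \<bar>\<psi> l k x\<bar>) \<le> C * 2 powr (real l / 2)"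
    and f0: "\<And>x. x \<in> {0..1} \<Longrightarrow> (\<lambda>l. wavelet_level \<psi> (wavelet_coeff \<psi> f0) l x) sums f0 x"
    and coeff: "\<And>l k. k < 2 ^ l \<Longrightarrow> \<bar>wavelet_coeff \<psi> f0 (l, k)\<bar> \<le> L * 2 powr (- (real l * (1 / 2 + \<beta>)))"
    and tail: "\<And>x. x \<ge> 0 \<Longrightarrow> ln (1 / h x) \<le> c1 * (1 + ln (1 + x) powr (1 + \<kappa>))"
    and mom: "integrable lborel (\<lambda>z. \<bar>z\<bar> powr q * h z)"
    and pars: "q \<ge> 1" "\<beta> > 0" "L > 0" "c1 \<ge> 0" "\<kappa> \<ge> 0" "A \<ge> 0"
    and s: "\<And>l. 0 < s l" "\<And>l. s l \<le> 1" "\<And>l. 2 powr (- A * (real l + 1)\<^sup>2) \<le> s l"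
      "\<And>l. l0 \<le> l \<Longrightarrow> s l \<le> 2 powr (- (real l * (1 / 2 + \<beta> + 1 / q)))"
    and n: "n > 0"
    and big: "8 \<le> ln n" "2 * L \<le> ln n" "C * (14 + 1 / (1 - 2 powr (- \<beta> / 2))) \<le> ln n"
      "32 * (1 + c1 + c1 * (ln (L + 2) + 49 * A * ln 2) powr (1 + \<kappa>)) \<le> ln n"
      "l0 * (1 + 2 * \<beta>) \<le> ln n" "exp (- ((ln n)\<^sup>2 / (32 * L\<^sup>2))) \<le> 1 / 4"
  shows "expected_posterior_sup \<psi> h s f0 n (ln n powr (5 + \<kappa>) * (ln n / n) powr (\<beta> / (2 * \<beta> + 1)))
    \<le> ennreal (6 * (n * (ln n)\<^sup>2) * exp (- (ln n ^ 4 / 32))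
        + exp (1 / 2) * (1 + exp 1) / h 1 * (\<integral>z. \<bar>z\<bar> powr q * h z \<partial>lborel) * 2 powr q / ln n
            * (1 / (1 - 2 powr (- \<beta> / 2)))
        + 8 * (n * (ln n)\<^sup>2) * exp (- ((ln n)\<^sup>2 / (32 * L\<^sup>2))))"
proof -
  define y \<rho> where "y = n * (ln n)\<^sup>2" and "\<rho> = 2 powr (- \<beta> / 2)"
  define E1 where "E1 = 3 * exp (- (ln n ^ 4 / 32))"
  define E2 where "E2 = exp (1 / 2) * (1 + exp 1) / h 1 * (\<integral>z. \<bar>z\<bar> powr q * h z \<partial>lborel) * 2 powr q / ln n"
  define E3 where "E3 = 4 * y * exp (- ((ln n)\<^sup>2 / (32 * L\<^sup>2)))"
  have \<rho>: "0 \<le> \<rho>" "\<rho> < 1" using pars by (auto simp: \<rho>_def powr_less_one)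
  have "1 \<le> (ln n)\<^sup>2" using big(1) by simp
  then have ny: "n \<le> y" using mult_left_mono[of 1 "(ln n)\<^sup>2" "real n"] by (simp add: y_def)
  then have y1: "y \<ge> 1" using n by linarith
  have C: "C \<ge> 0" using loc[of 0 0] by (simp add: order_trans[OF sum_nonneg])
  obtain J where J: "y \<le> 2 powr (real J * (1 + 2 * \<beta>))" "2 ^ J \<le> 2 * y powr (1 / (1 + 2 * \<beta>))"
    using level_cutoff[OF y1, of "1 + 2 * \<beta>"] pars by auto
  have "y powr (1 / (1 + 2 * \<beta>)) \<le> y powr 1" using y1 pars by (intro powr_mono) auto
  then have J': "2 ^ J \<le> 2 * y" using J(2) y1 by simp
  \<comment> \<open>From 2^J \<le> 2 n (ln n)^2, using ln (ln n) \<le> ln n - 1 and ln 2 \<ge>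
    2/3.\<close>
  have J7: "J \<le> 7 * ln n"
  proof -
    have "J * ln 2 = ln (2 ^ J)" by (simp add: ln_realpow)
    also have "\<dots> \<le> ln (2 * y)" using J' by (intro ln_mono) auto
    also have "\<dots> = ln 2 + ln n + 2 * ln (ln n)"
      using n big(1) by (cases "n = 1") (simp_all add: y_def ln_mult ln_realpow)
    also have "\<dots> \<le> 1 + 3 * ln n"
      using big(1) ln_le_minus_one[of "ln n"] ln_2_less_1 by simp
    finally have "J * ln 2 \<le> 1 + 3 * ln n" .
    moreover have "J * (2 / 3) \<le> J * ln 2" using ln2_ge_two_thirds by (intro mult_left_mono) auto
    ultimately show ?thesis using big(1) by simp
  qed
  \<comment> \<open>The fine-level bound needs the upper bound on \<open>s l\<close>, which is
    available only from \<open>l0\<close> on.\<close>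
  have Jl0: "l0 \<le> J"
  proof -
    have "l0 * (1 + 2 * \<beta>) \<le> ln y" using order_trans[OF big(5) ln_mono[OF ny]] n by simp
    also have "\<dots> \<le> ln (2 powr (real J * (1 + 2 * \<beta>)))" using J(1) y1 by (intro ln_mono) auto
    also have "\<dots> = J * (1 + 2 * \<beta>) * ln 2" by (simp add: ln_powr)
    also have "\<dots> \<le> J * (1 + 2 * \<beta>) * 1" using ln_2_less_1 pars by (intro mult_left_mono) auto
    finally show ?thesis using pars by simp
  qed
  \<comment> \<open>\<open>b l\<close> bounds the total contribution of level \<open>l\<close>; each
    of its coordinates receives the share \<open>b l / 2 ^ l\<close>.\<close>
  define b where "b l = (if l < J then 2 ^ l * E1 else E2 * \<rho> ^ (l - J) + E3 * (1 / 2) ^ (l - J))" for l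
  have m0: "(\<integral>z. \<bar>z\<bar> powr q * h z \<partial>lborel) \<ge> 0"
    using h_pos by (intro integral_nonneg_AE) (auto simp: less_imp_le)
  have E2_0: "E2 \<ge> 0"
    unfolding E2_def using m0 big(1) less_imp_le[OF h_pos[of 1]]
    by (intro divide_nonneg_nonneg mult_nonneg_nonneg add_nonneg_nonneg) auto
  have E0: "E1 \<ge> 0" "E2 \<ge> 0" "E3 \<ge> 0" using E2_0 y1 by (auto simp: E1_def E3_def)
  have b0: "b l \<ge> 0" for l using E0 \<rho> by (simp add: b_def)
  have tsum: "summable (\<lambda>l. C * 2 powr (real l / 2) * threshold \<beta> (2 + \<kappa>) n J l)"
    "(\<Sum>l. C * 2 powr (real l / 2) * threshold \<beta> (2 + \<kappa>) n J l)
      \<le> ln n powr (5 + \<kappa>) * (ln n / n) powr (\<beta> / (2 * \<beta> + 1))"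
    using threshold_sum[of \<beta> C "2 + \<kappa>" n J] pars C n big J J7 by (simp_all add: y_def add.commute)
  have g: "(\<integral>\<^sup>+x. emeasure (posterior_coord h (s l) n x)
        {\<theta>. threshold \<beta> (2 + \<kappa>) n J l < \<bar>\<theta> - wavelet_coeff \<psi> f0 (l, k)\<bar>}
        \<partial>density lborel (normal_density (wavelet_coeff \<psi> f0 (l, k)) (1 / sqrt (real n))))
      \<le> ennreal (b l / 2 ^ l)" if k: "k < 2 ^ l" for l k
  proof (cases "l < J")
    case True
    have "L * 2 powr (- (real l * (1 / 2 + \<beta>))) \<le> L * 2 powr 0"
      using pars by (intro mult_left_mono powr_mono) auto
    then have "\<bar>wavelet_coeff \<psi> f0 (l, k)\<bar> \<le> L" using coeff[OF k] by simp
    from expected_posterior_coord_below_cutoff[OF tail s(1-3) _ _ this _ _ n True J7 big(1,4)] True pars show ?thesis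
      by (simp add: b_def E1_def)
  next
    case False
    then have l: "J \<le> l" by simp
    have "l0 \<le> l" using l Jl0 by simp
    from expected_posterior_coord_above_cutoff[OF mom pars(1-3) n l s(1) s(4)[OF this] coeff[OF k] J(1)[unfolded y_def] J'[unfolded y_def] _ big(2,6)]
      big(1) False show ?thesis
      by (simp add: b_def E2_def E3_def y_def \<rho>_def)
  qed
  have shift: "(\<lambda>i. b (i + J)) sums (E2 * (1 / (1 - \<rho>)) + E3 * 2)"
  proof -
    have "(\<lambda>i. E2 * \<rho> ^ i + E3 * (1 / 2) ^ i) sums (E2 * (1 / (1 - \<rho>)) + E3 * (1 / (1 - 1 / 2)))"
      using \<rho> by (intro sums_add sums_mult geometric_sums) auto
    then show ?thesis by (simp add: b_def)
  qed
  then have sb: "summable b" using sums_summable summable_iff_shift by blast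
  have "expected_posterior_sup \<psi> h s f0 n (ln n powr (5 + \<kappa>) * (ln n / n) powr (\<beta> / (2 * \<beta> + 1)))
      \<le> (\<Sum>l. 2 ^ l * ennreal (b l / 2 ^ l))"
    by (rule expected_posterior_sup_le[OF n s(1) loc f0 tsum g])
  also have "\<dots> = (\<Sum>l. ennreal (b l))"
  proof (rule suminf_cong)
    fix l
    have "(2 :: ennreal) ^ l = ennreal (2 ^ l)" by (simp flip: ennreal_power)
    then show "2 ^ l * ennreal (b l / 2 ^ l) = ennreal (b l)"
      using b0[of l] by (simp add: ennreal_mult[symmetric])
  qed
  also have "\<dots> = ennreal (suminf b)" using b0 sb by (intro suminf_ennreal2) auto
  also have "\<dots> \<le> ennreal (6 * y * exp (- (ln n ^ 4 / 32)) + E2 * (1 / (1 - \<rho>)) + E3 * 2)"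
  proof (rule ennreal_leI)
    have "(\<Sum>l<J. b l) = (\<Sum>l<J. 2 ^ l) * E1" by (simp add: b_def sum_distrib_right)
    also have "\<dots> \<le> 2 * y * E1"
      using J' E0 geometric_sum[of "2 :: real" J] by (intro mult_right_mono) auto
    finally have "(\<Sum>l<J. b l) \<le> 6 * y * exp (- (ln n ^ 4 / 32))" by (simp add: E1_def)
    then show "suminf b \<le> 6 * y * exp (- (ln n ^ 4 / 32)) + E2 * (1 / (1 - \<rho>)) + E3 * 2"
      using suminf_split_initial_segment[OF sb, of J] sums_unique[OF shift] by simp
  qed
  finally show ?thesis by (simp add: y_def E2_def E3_def \<rho>_def mult.assoc)
qed

text \<open>Exponentials of - (ln n)^4 and - (ln n)^2, up to constants, beat the polynomial number
  of coordinates at the cutoff. The slowest term is of order 1 / ln n; it comes from the factor ln n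
  in the fine thresholds.\<close>

lemma expected_posterior_sup_tendsto:
  fixes l0 :: nat and s :: "nat \<Rightarrow> real" and \<beta> L C A c1 \<kappa> q :: real
  assumes loc: "\<And>l x. x \<in> {0..1} \<Longrightarrow> (\<Sum>k<2 ^ l. \<bar>\<psi> l k x\<bar>) \<le> C * 2 powr (real l / 2)"
    and f0: "\<And>x. x \<in> {0..1} \<Longrightarrow> (\<lambda>l. wavelet_level \<psi> (wavelet_coeff \<psi> f0) l x) sums f0 x"
    and coeff: "\<And>l k. k < 2 ^ l \<Longrightarrow> \<bar>wavelet_coeff \<psi> f0 (l, k)\<bar> \<le> L * 2 powr (- (real l * (1 / 2 + \<beta>)))"
    and tail: "\<And>x. x \<ge> 0 \<Longrightarrow> ln (1 / h x) \<le> c1 * (1 + ln (1 + x) powr (1 + \<kappa>))"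
    and mom: "integrable lborel (\<lambda>z. \<bar>z\<bar> powr q * h z)"
    and pars: "q \<ge> 1" "\<beta> > 0" "L > 0" "c1 \<ge> 0" "\<kappa> \<ge> 0" "A \<ge> 0"
    and s: "\<And>l. 0 < s l" "\<And>l. s l \<le> 1" "\<And>l. 2 powr (- A * (real l + 1)\<^sup>2) \<le> s l"
      "\<And>l. l0 \<le> l \<Longrightarrow> s l \<le> 2 powr (- (real l * (1 / 2 + \<beta> + 1 / q)))"
  shows "(\<lambda>n. expected_posterior_sup \<psi> h s f0 n
    (ln n powr (5 + \<kappa>) * (ln n / n) powr (\<beta> / (2 * \<beta> + 1)))) \<longlonglongrightarrow> 0"
proof -
  define c D where "c = 1 / (32 * L\<^sup>2)"
    and "D = exp (1 / 2) * (1 + exp 1) / h 1 * (\<integral>z. \<bar>z\<bar> powr q * h z \<partial>lborel) * 2 powr q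
      * (1 / (1 - 2 powr (- \<beta> / 2)))"
  define \<epsilon> where "\<epsilon> n = 6 * (real n * (ln n)\<^sup>2) * exp (- (ln n ^ 4 / 32)) + D / ln n
      + 8 * (n * (ln n)\<^sup>2) * exp (- ((ln n)\<^sup>2 * c))" for n :: nat
  have c: "c > 0" using pars by (simp add: c_def)
  have "\<epsilon> \<longlonglongrightarrow> 0"
    unfolding \<epsilon>_def using c by real_asymp
  then have lim: "(\<lambda>n. ennreal (\<epsilon> n)) \<longlonglongrightarrow> 0"
    using tendsto_ennrealI[of \<epsilon> 0] by simp
  have ln_ge: "\<forall>\<^sub>F n in sequentially. K \<le> ln (real n)" for K
    using filterlim_compose[OF ln_at_top filterlim_real_sequentially]
    by (simp add: filterlim_at_top)
  have small: "\<forall>\<^sub>F n in sequentially. exp (- ((ln (real n))\<^sup>2 * c)) \<le> 1 / 4"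
  proof -
    have "(\<lambda>n. exp (- ((ln (real n))\<^sup>2 * c))) \<longlonglongrightarrow> 0" using c by real_asymp
    from order_tendstoD(2)[OF this, of "1 / 4"] show ?thesis by (auto elim: eventually_mono)
  qed
  have "\<forall>\<^sub>F n in sequentially. expected_posterior_sup \<psi> h s f0 n
      (ln n powr (5 + \<kappa>) * (ln n / n) powr (\<beta> / (2 * \<beta> + 1))) \<le> ennreal (\<epsilon> n)"
    using eventually_gt_at_top[of 0] ln_ge[of 8] ln_ge[of "2 * L"]
      ln_ge[of "C * (14 + 1 / (1 - 2 powr (- \<beta> / 2)))"]
      ln_ge[of "32 * (1 + c1 + c1 * (ln (L + 2) + 49 * A * ln 2) powr (1 + \<kappa>))"]
      ln_ge[of "l0 * (1 + 2 * \<beta>)"] small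
  proof eventually_elim
    case (elim n)
    have "expected_posterior_sup \<psi> h s f0 n (ln n powr (5 + \<kappa>) * (ln n / n) powr (\<beta> / (2 * \<beta> + 1)))
      \<le> ennreal (6 * (n * (ln n)\<^sup>2) * exp (- (ln n ^ 4 / 32))
        + exp (1 / 2) * (1 + exp 1) / h 1 * (\<integral>z. \<bar>z\<bar> powr q * h z \<partial>lborel) * 2 powr q / ln n
            * (1 / (1 - 2 powr (- \<beta> / 2)))
        + 8 * (n * (ln n)\<^sup>2) * exp (- ((ln n)\<^sup>2 / (32 * L\<^sup>2))))"
      by (rule expected_posterior_sup_bound[OF loc f0 coeff tail mom pars s])
         (use elim in \<open>simp_all add: c_def\<close>)
    then show ?case by (simp add: \<epsilon>_def c_def D_def ac_simps)
  qed
  then show ?thesis by (intro tendsto_sandwich[OF _ _ tendsto_const lim]) auto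
qed

end

theorem theorem3:
  fixes \<psi> :: "nat \<Rightarrow> nat \<Rightarrow> real \<Rightarrow> real" and h f0 :: "real \<Rightarrow> real"
    and c1 \<kappa> q \<beta> L :: real
  assumes "wavelet_basis \<psi>"
    and "c1 > 0" and "\<kappa> \<ge> 0" and "q \<ge> 1"
    and "heavy_tailed_density h c1 \<kappa> q"
    and "\<beta> > 0" and "L > 0" and "f0 \<in> holder_ball \<psi> \<beta> L"
  shows "(\<exists>d>0. (\<lambda>n. expected_posterior_sup \<psi> h (\<lambda>l. 2 powr (- (real l)\<^sup>2)) f0 n
             (ln (real n) powr d * (ln (real n) / real n) powr (\<beta> / (2 * \<beta> + 1)))) \<longlonglongrightarrow> 0) \<and>
         (\<forall>\<alpha>>0. \<alpha> \<ge> \<beta> + 1 / q \<longrightarrow>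
           (\<exists>d>0. (\<lambda>n. expected_posterior_sup \<psi> h (\<lambda>l. 2 powr (- real l * (1/2 + \<alpha>))) f0 n
             (ln (real n) powr d * (ln (real n) / real n) powr (\<beta> / (2 * \<beta> + 1)))) \<longlonglongrightarrow> 0))"
proof -
  have ht: "h \<in> borel_measurable borel" "integrable lborel h" "integral\<^sup>L lborel h = 1"
    "\<And>x. h (- x) = h x" "\<And>x. h x > 0" "antimono_on {0..} h"
    "\<And>x. x \<ge> 0 \<Longrightarrow> ln (1 / h x) \<le> c1 * (1 + ln (1 + x) powr (1 + \<kappa>))"
    "integrable lborel (\<lambda>x. \<bar>x\<bar> powr q * h x)"
    using assms(5) by (auto simp: heavy_tailed_density_def)
  interpret even_density h using ht by unfold_locales
  obtain C where C: "\<And>l x. x \<in> {0..1} \<Longrightarrow> (\<Sum>k<2 ^ l. \<bar>\<psi> l k x\<bar>) \<le> C * 2 powr (real l / 2)"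
    using assms(1) unfolding wavelet_basis_def by blast
  have f0: "\<And>x. x \<in> {0..1} \<Longrightarrow> (\<lambda>l. wavelet_level \<psi> (wavelet_coeff \<psi> f0) l x) sums f0 x"
    using assms(8) by (auto simp: holder_ball_def)
  have coeff: "\<bar>wavelet_coeff \<psi> f0 (l, k)\<bar> \<le> L * 2 powr (- (real l * (1 / 2 + \<beta>)))" if "k < 2 ^ l" for l k
  proof -
    have "\<bar>wavelet_coeff \<psi> f0 (l, k)\<bar> \<le> (MAX k\<in>{..<2 ^ l}. \<bar>wavelet_coeff \<psi> f0 (l, k)\<bar>)"
      using that by (intro Max_ge) auto
    also have "\<dots> \<le> 2 powr (- real l * (1/2 + \<beta>)) * L" using assms(8) by (auto simp: holder_ball_def)
    finally show ?thesis by (simp add: mult.commute)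
  qed
  note contraction = expected_posterior_sup_tendsto[OF C f0 coeff ht(7,8) assms(4,6,7)
      less_imp_le[OF assms(2)] assms(3)]
  have q: "0 \<le> 1 / q" using assms(4) by simp
  have "(\<lambda>n. expected_posterior_sup \<psi> h (\<lambda>l. 2 powr (- (real l)\<^sup>2)) f0 n
      (ln (real n) powr (5 + \<kappa>) * (ln (real n) / real n) powr (\<beta> / (2 * \<beta> + 1)))) \<longlonglongrightarrow> 0"
  \<comment> \<open>Here A = 1. From the chosen level on, l is at least 1/2 + \<beta> + 1/q, so l^2
    dominates the required linear exponent.\<close>
  proof (rule contraction[of 1 _ "nat \<lceil>1 / 2 + \<beta> + 1 / q\<rceil>"])
    fix l assume "nat \<lceil>1 / 2 + \<beta> + 1 / q\<rceil> \<le> l"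
    then have "1 / 2 + \<beta> + 1 / q \<le> real l" by linarith
    then have "real l * (1 / 2 + \<beta> + 1 / q) \<le> (real l)\<^sup>2"
      unfolding power2_eq_square by (intro mult_left_mono) auto
    then show "2 powr (- (real l)\<^sup>2) \<le> 2 powr (- (real l * (1 / 2 + \<beta> + 1 / q)))"
      by (intro powr_mono) auto
  next
    fix l :: nat
    show "2 powr (- (real l)\<^sup>2) \<le> (1 :: real)" using powr_mono[of "- (real l)\<^sup>2" 0 2] by simp
    show "2 powr (- 1 * (real l + 1)\<^sup>2) \<le> 2 powr (- (real l)\<^sup>2)"
      by (intro powr_mono) (auto simp: power_mono)
  qed auto
  moreover have "(\<lambda>n. expected_posterior_sup \<psi> h (\<lambda>l. 2 powr (- real l * (1/2 + \<alpha>))) f0 n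
      (ln (real n) powr (5 + \<kappa>) * (ln (real n) / real n) powr (\<beta> / (2 * \<beta> + 1)))) \<longlonglongrightarrow> 0"
    if \<alpha>: "\<alpha> > 0" "\<alpha> \<ge> \<beta> + 1 / q" for \<alpha>
  \<comment> \<open>The condition \<alpha> \<ge> \<beta> + 1/q is the required bound on the scales
    at every level, so \<open>l0\<close> is 0.\<close>
  proof (rule contraction[of "1 / 2 + \<alpha>" _ 0])
    fix l :: nat
    have "real l * (1 / 2 + \<beta> + 1 / q) \<le> real l * (1 / 2 + \<alpha>)" using \<alpha> by (intro mult_left_mono) auto
    then show "2 powr (- real l * (1/2 + \<alpha>)) \<le> 2 powr (- (real l * (1 / 2 + \<beta> + 1 / q)))"
      by (intro powr_mono) auto
    have "0 \<le> real l * (1 / 2 + \<alpha>)" using \<alpha> by simp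
    then show "2 powr (- real l * (1/2 + \<alpha>)) \<le> (1 :: real)"
      using powr_mono[of "- real l * (1/2 + \<alpha>)" 0 2] by simp
    \<comment> \<open>The linear exponent is put into the quadratic form of the lower bound on the
      scales by l \<le> (l + 1)^2.\<close>
    have "real l * (1 / 2 + \<alpha>) \<le> (real l + 1)\<^sup>2 * (1 / 2 + \<alpha>)"
      using \<alpha> by (intro mult_right_mono) (auto simp: power2_eq_square algebra_simps)
    then show "2 powr (- (1 / 2 + \<alpha>) * (real l + 1)\<^sup>2) \<le> 2 powr (- real l * (1/2 + \<alpha>))"
      by (intro powr_mono) (simp_all only: mult_minus_left neg_le_iff_le mult.commute)
  qed (use \<alpha> in auto)
  ultimately show ?thesis using assms(3) by (auto intro!: exI[of _ "5 + \<kappa>"])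
qed

end
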